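(* Let $C,C'\subset(\mathbb{R}^+)^d$ be convex bodies and let $F:\mathbb{C}^d\to\mathbb{C}^d$ be a proper polynomial mapping satisfying $$0<\liminf_{|z|\to\infty}\frac{\sup_{J\in C}|F(z)^J|}{\sup_{J'\in C'}|z^{J'}|}\le\limsup_{|z|\to\infty}\frac{\sup_{J\in C}|F(z)^J|}{\sup_{J'\in C'}|z^{J'}|}<\infty.$$ Then for every compact $K\subset\mathbb{C}^d$, $V_{C,K}(F(z))=V_{C',F^{-1}(K)}(z)$ for all $z\in\mathbb{C}^d$.
   Context: Throughout, a convex body $C\subset(\mathbb{R}^+)^d$ is assumed to satisfy $\Sigma\subset kC$ for some positive integer $k$, where $\Sigma=\{x\in\mathbb{R}^d:x_i\ge0,\ \sum x_i\le1\}$. For $w\in\mathbb{C}^d$ and $J\in(\mathbb{R}^+)^d$, $|w^J|=|w_1|^{j_1}\cdots|w_d|^{j_d}$. $H_C(z)=\sup_{J\in C}\log|z^J|$; $L_C$ is the class of plurisubharmonic $u$ on $\mathbb{C}^d$ with $u\le H_C+c_u$ for some constant. For compact $K$, $V_{C,K}(z)=\sup\{u(z): u\in L_C,\ u\le0\text{ on }K\}$. *)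

theory Defs
  imports "HOL-Analysis.Analysis"
begin

text \<open>|w^J| = |w_1|^{j_1} ... |w_d|^{j_d}, with the convention 0^0 = 1.\<close>
definition mon_abs :: "complex^'d \<Rightarrow> real^'d \<Rightarrow> real" where
  "mon_abs w J = (\<Prod>i\<in>UNIV. (if J$i = 0 then 1 else norm (w$i) powr (J$i)))"

definition std_simplex :: "(real^'d) set" where
  "std_simplex = {x. (\<forall>i. 0 \<le> x$i) \<and> (\<Sum>i\<in>UNIV. x$i) \<le> 1}"

definition convex_body :: "(real^'d) set \<Rightarrow> bool" where
  "convex_body C \<longleftrightarrow> compact C \<and> convex C \<and> interior C \<noteq> {}"

text \<open>Standing assumptions on C: a convex body in (R^+)^d with Sigma \<subseteq> kC for
  some positive integer k.\<close>
definition admissible_body :: "(real^'d) set \<Rightarrow> bool" where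
  "admissible_body C \<longleftrightarrow> convex_body C \<and> (\<forall>J\<in>C. \<forall>i. 0 \<le> J$i) \<and>
     (\<exists>k::nat. 0 < k \<and> std_simplex \<subseteq> (\<lambda>x. real k *\<^sub>R x) ` C)"

definition sup_mon :: "(real^'d) set \<Rightarrow> complex^'d \<Rightarrow> real" where
  "sup_mon C w = (SUP J\<in>C. mon_abs w J)"

definition H_C :: "(real^'d) set \<Rightarrow> complex^'d \<Rightarrow> ereal" where
  "H_C C z = (SUP J\<in>C. (if mon_abs z J = 0 then -\<infinity> else ereal (ln (mon_abs z J))))"

text \<open>Plurisubharmonic functions on C^d (values in [-\<infinity>,\<infinity>)): upper semicontinuous and
  subharmonic on every complex line, i.e. sub-mean-value property on every circle
  a + e^{it} b.  The (possibly -\<infinity>) circle mean of u is written as the infimum of the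
  circle means of the bounded truncations max u (-n) (monotone convergence).\<close>
definition circle_mean :: "(complex^'d \<Rightarrow> ereal) \<Rightarrow> complex^'d \<Rightarrow> complex^'d \<Rightarrow> ereal" where
  "circle_mean u a b = (INF n::nat. ereal (integral {0..2*pi}
       (\<lambda>t. real_of_ereal (max (u (a + cis t *s b)) (- ereal (real n)))) / (2*pi)))"

definition psh :: "(complex^'d \<Rightarrow> ereal) \<Rightarrow> bool" where
  "psh u \<longleftrightarrow> (\<forall>z. u z < \<infinity>) \<and> (\<forall>c. open {z. u z < c}) \<and>
     (\<forall>a b. u a \<le> circle_mean u a b)"

definition L_C :: "(real^'d) set \<Rightarrow> (complex^'d \<Rightarrow> ereal) set" where
  "L_C C = {u. psh u \<and> (\<exists>c::real. \<forall>z. u z \<le> H_C C z + ereal c)}"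

definition V_CK :: "(real^'d) set \<Rightarrow> (complex^'d) set \<Rightarrow> complex^'d \<Rightarrow> ereal" where
  "V_CK C K z = (SUP u\<in>{u \<in> L_C C. \<forall>w\<in>K. u w \<le> 0}. u z)"

definition poly_fun :: "(complex^'d \<Rightarrow> complex) \<Rightarrow> bool" where
  "poly_fun p \<longleftrightarrow> (\<exists>S c. finite (S :: (nat^'d) set) \<and>
      (\<forall>z. p z = (\<Sum>\<alpha>\<in>S. c \<alpha> * (\<Prod>j\<in>UNIV. (z$j) ^ (\<alpha>$j)))))"

definition poly_map :: "(complex^'d \<Rightarrow> complex^'d) \<Rightarrow> bool" where
  "poly_map F \<longleftrightarrow> (\<forall>i. poly_fun (\<lambda>z. F z $ i))"

definition is_proper_map :: "(complex^'d \<Rightarrow> complex^'d) \<Rightarrow> bool" where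
  "is_proper_map F \<longleftrightarrow> (\<forall>K. compact K \<longrightarrow> compact (F -` K))"

end

theory Submission
  imports Defs "HOL-Complex_Analysis.Conformal_Mappings"
begin

text \<open>The two inequalities come from \<open>u \<mapsto> u \<circ> F\<close> and from \<open>v \<mapsto> (w \<mapsto> max {v z | F z = w})\<close>; the growth
  condition says that these maps exchange \<open>L_C\<close> and \<open>L_C'\<close>, so the point is that both preserve
  plurisubharmonicity. Both cases follow from one doubling of variables, which replaces smoothing of psh
  functions as well as the theory of branched coverings. To bound \<open>u (F a)\<close> by \<open>Re p 0\<close> when \<open>u \<circ> F < Re p\<close>
  on a circle \<open>a + \<zeta> b\<close>, maximise \<open>u z - Re p \<zeta> - \<delta> (1 - |\<zeta>|\<^sup>2) - k |g z \<zeta>|\<^sup>2\<close> with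
  \<open>g z \<zeta> = z - F (a + \<zeta> b)\<close> and \<open>k\<close> large. From an interior maximum move along \<open>(z + s c, \<zeta> + s)\<close>, where \<open>c\<close>
  is chosen such that \<open>g\<close> changes by a holomorphic \<open>h s = O(s\<^sup>2)\<close>: the mean of \<open>|g + h|\<^sup>2\<close> exceeds \<open>|g|\<^sup>2\<close>
  only by \<open>O(|s|\<^sup>4)\<close>, whereas \<open>\<delta> |\<zeta>|\<^sup>2\<close> gains \<open>\<delta> |s|\<^sup>2\<close>, contradicting the submean property of \<open>u\<close>.
  For the fibre maximum take \<open>g z \<zeta> = F z - w - \<zeta> b\<close> and replace \<open>v\<close> by \<open>v + \<epsilon> log |det F'|\<close>, so that the
  maximum is attained at a noncritical point, where \<open>F' c = b\<close> is solvable; then let \<open>\<epsilon>\<close> tend to 0.\<close>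

subsection \<open>Upper semicontinuous functions and circle means\<close>

definition usc :: "('a::topological_space \<Rightarrow> ereal) \<Rightarrow> bool" where
  "usc f \<longleftrightarrow> (\<forall>c. open {x. f x < c})"

lemma uscD: "usc f \<Longrightarrow> open {x. f x < c}"
  by (simp add: usc_def)

lemma usc_closed_ge: "usc f \<Longrightarrow> closed {x. c \<le> f x}"
  using uscD[of f c] by (simp add: closed_def Collect_neg_eq[symmetric] not_le)

lemma usc_attains_max:
  fixes f :: "'a::topological_space \<Rightarrow> ereal"
  assumes "usc f" "compact K" "K \<noteq> {}"
  obtains x where "x \<in> K" "\<And>y. y \<in> K \<Longrightarrow> f y \<le> f x"
proof (rule ccontr)
  assume "\<not> thesis"
  then have "\<forall>x\<in>K. \<exists>y\<in>K. f x < f y" using that by (meson not_le)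
  \<comment> \<open>If no value is maximal, the open sets \<open>{x. f x < f y}\<close> cover
    \<open>K\<close>; the centre with the largest value in a finite subcover then contradicts its
    own covering.\<close>
  then have cov: "K \<subseteq> (\<Union>y\<in>K. {x. f x < f y})" by blast
  obtain D where D: "D \<subseteq> K" "finite D" "K \<subseteq> (\<Union>y\<in>D. {x. f x < f y})"
    using compactE_image[OF assms(2) _ cov] uscD[OF assms(1)] by metis
  then have "D \<noteq> {}" using assms(3) by auto
  then have "Max (f ` D) \<in> f ` D" using D(2) by simp
  then obtain y where "y \<in> D" "f y = Max (f ` D)" by auto
  moreover then obtain z where "z \<in> D" "f y < f z" using D(1,3) by blast
  ultimately show False using D(2) by (metis Max_ge finite_imageI image_eqI not_le)
qed

text \<open>A sum lies below \<open>c\<close> exactly when its terms lie below reals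
  \<open>a\<close>, \<open>b\<close> with \<open>a + b < c\<close>, so the sublevel set is a union
  of open sets. Values below \<infinity> rule out the ambiguous sum of \<infinity> and
  -\<infinity>.\<close>

lemma usc_add:
  assumes "usc f" "usc g" "\<And>x. f x < \<infinity>" "\<And>x. g x < \<infinity>"
  shows "usc (\<lambda>x. f x + g x)"
  unfolding usc_def
proof
  fix c :: ereal
  have "{x. f x + g x < c} = (\<Union>(a::real)\<in>UNIV. \<Union>(b::real)\<in>{b. ereal (a + b) < c}. {x. f x < ereal a} \<inter> {x. g x < ereal b})" (is "?L = ?R")
  proof
    show "?R \<subseteq> ?L"
    proof clarsimp
      fix a b :: real and x assume "ereal (a + b) < c" "f x < ereal a" "g x < ereal b"
      then show "f x + g x < c"
        by (metis add_mono less_imp_le order.strict_trans1 plus_ereal.simps(1))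
    qed
    show "?L \<subseteq> ?R"
    proof
      fix x assume "x \<in> ?L"
      then have lt: "f x + g x < c" by simp
      have "\<exists>a b::real. ereal (a + b) < c \<and> f x < a \<and> g x < b"
      proof -
        obtain c' :: real where c': "f x + g x < ereal c'" "ereal c' < c"
          using lt ereal_dense2 by blast
        show ?thesis
        proof (cases "f x")
          case (real r)
          show ?thesis
          proof (cases "g x")
            case (real s)
            with \<open>f x = ereal r\<close> c' have "r + s < c'" by simp
            then have "r < r + (c' - r - s)/2" "s < s + (c' - r - s)/2" by simp_all
            moreover have "(r + (c' - r - s)/2) + (s + (c' - r - s)/2) = c'" by (simp add: field_simps)
            ultimately show ?thesis using \<open>f x = ereal r\<close> real c' by (metis less_ereal.simps(1))
          next
            case MInf
            then show ?thesis using real c'(2)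
              by (intro exI[of _ "r+1"] exI[of _ "c' - (r+1)"]) simp
          qed (use assms(4)[of x] in auto)
        next
          case MInf
          obtain s :: real where "g x < ereal s" using assms(4)[of x] ereal_dense2 by blast
          then show ?thesis using MInf c'(2)
            by (intro exI[of _ "c' - s"] exI[of _ "s"]) simp
        qed (use assms(3)[of x] in auto)
      qed
      then show "x \<in> ?R" by auto
    qed
  qed
  moreover have "open ?R" by (intro open_UN ballI open_Int uscD assms)
  ultimately show "open ?L" by simp
qed

lemma usc_continuous:
  fixes f :: "'a::topological_space \<Rightarrow> real"
  assumes "continuous_on UNIV f"
  shows "usc (\<lambda>x. ereal (f x))"
  unfolding usc_def
proof
  fix c
  show "open {x. ereal (f x) < c}"
    using open_vimage[OF _ assms, of "{..<real_of_ereal c}"]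
    by (cases c) (auto simp: vimage_def)
qed

lemma usc_compose:
  assumes "usc f" "continuous_on UNIV h"
  shows "usc (\<lambda>x. f (h x))"
  using open_vimage[OF uscD[OF assms(1)] assms(2)] by (simp add: usc_def vimage_def)

lemma norm_vector_smult: "norm (s *s (c :: complex^'n)) = norm s * norm c"
  unfolding norm_vec_def L2_set_def
  by (simp add: norm_mult power_mult_distrib sum_distrib_left[symmetric] real_sqrt_mult)

lemma continuous_on_vector_smult [continuous_intros]:
  assumes "continuous_on S f" "continuous_on S g"
  shows "continuous_on S (\<lambda>x. f x *s (g x :: complex^'n))"
proof -
  have "continuous_on S (\<lambda>x. \<chi> i. f x * g x $ i)"
    by (intro continuous_intros assms)
  then show ?thesis by (simp add: vector_scalar_mult_def)
qed

section \<open>Circle means and harmonic majorants\<close>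

lemma holomorphic_mean_value:
  assumes "H holomorphic_on ball 0 R" "0 < r" "r < R"
  shows "((\<lambda>t. Re (H (of_real r * cis t))) has_integral (2 * pi * Re (H 0))) {0..2*pi}"
proof -
  have "((\<lambda>u. H u/(u-0)) has_contour_integral (2 * of_real pi * \<i> * H 0)) (circlepath 0 r)"
  proof (rule Cauchy_integral_circlepath)
    show "continuous_on (cball 0 r) H"
      by (rule holomorphic_on_imp_continuous_on[OF holomorphic_on_subset[OF assms(1)]]) (use assms in auto)
    show "H holomorphic_on ball 0 r" by (rule holomorphic_on_subset[OF assms(1)]) (use assms in auto)
  qed (use assms in auto)
  then have "((\<lambda>t. H (0 + r * cis t) / (0 + r * cis t - 0) * r * \<i> * cis t) has_integral (2 * of_real pi * \<i> * H 0)) {0..2*pi}"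
    unfolding circlepath_def by (subst (asm) has_contour_integral_part_circlepath_iff) auto
  then have "((\<lambda>t. \<i> * H (r * cis t)) has_integral (\<i> * (2 * of_real pi * H 0))) {0..2*pi}"
    by (rule has_integral_eq_rhs[OF has_integral_eq, rotated]) (use assms in \<open>auto simp: field_simps\<close>)
  \<comment> \<open>The kernel du/u on the circle is i dt; the imaginary part of i times
    \<open>H\<close> is the real part of \<open>H\<close>.\<close>
  then have "((\<lambda>t. Im (\<i> * H (r * cis t))) has_integral Im (\<i> * (2 * of_real pi * H 0))) {0..2*pi}"
    by (rule has_integral_Im)
  then show ?thesis by simp
qed

text \<open>Truncation bounds the function below, the attained maximum bounds it above, and open
  sublevel sets make it Borel. So the integrals in \<open>circle_mean\<close> are genuine, not the
  default value 0.\<close>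

lemma usc_bounded_integrable:
  fixes f :: "real \<Rightarrow> ereal"
  assumes "usc f" "\<And>t. f t < \<infinity>"
  shows "(\<lambda>t. real_of_ereal (max (f t) (- ereal n))) integrable_on {a..b}"
proof (cases "a \<le> b")
  case True
  let ?g = "\<lambda>t. real_of_ereal (max (f t) (- ereal n))"
  have eq: "ereal (?g t) = max (f t) (- ereal n)" for t
    using assms(2)[of t] by (cases "f t") (auto simp: max_def)
  obtain t0 where t0: "\<And>t. t \<in> {a..b} \<Longrightarrow> f t \<le> f t0"
    using usc_attains_max[OF assms(1), of "{a..b}"] True by (metis atLeastatMost_empty_iff2 compact_Icc not_le)
  show ?thesis
  proof (rule measurable_bounded_by_integrable_imp_integrable_real)
    have "?g \<in> borel_measurable borel"
    proof (rule borel_measurableI_less)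
      fix y :: real
      have "?g t < y \<longleftrightarrow> f t < ereal y \<and> - n < y" for t
        unfolding less_ereal.simps(1)[of "?g t" y, symmetric] eq by auto
      then have "{t. ?g t < y} = (if - n < y then {t. f t < ereal y} else {})" by auto
      then show "{t \<in> space borel. ?g t < y} \<in> sets borel"
        using uscD[OF assms(1), of "ereal y"] by auto
    qed
    then have "?g \<in> borel_measurable lebesgue"
      by (intro measurable_completion) simp
    then show "?g \<in> borel_measurable (lebesgue_on {a..b})"
      by (rule measurable_restrict_space1)
    show "(\<lambda>_. max \<bar>?g t0\<bar> \<bar>n\<bar>) integrable_on {a..b}" by auto
    fix t assume t: "t \<in> {a..b}"
    have "ereal (?g t) \<le> ereal (?g t0)" "ereal (-n) \<le> ereal (?g t)"
      unfolding eq using t0[OF t] by (auto simp: max.coboundedI1)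
    then have "?g t \<le> ?g t0" "-n \<le> ?g t" by (simp_all only: ereal_less_eq)
    then show "\<bar>?g t\<bar> \<le> max \<bar>?g t0\<bar> \<bar>n\<bar>" by arith
  qed auto
qed (use integrable_on_empty in auto)

text \<open>The sub-mean value inequality on a circle in dual form: the circle mean is replaced by all harmonic
  majorants. In this form the inequality passes to maxima and needs no integration.\<close>
definition submean_at :: "(complex^'d \<Rightarrow> ereal) \<Rightarrow> complex^'d \<Rightarrow> complex^'d \<Rightarrow> real \<Rightarrow> bool" where
  "submean_at u z c r \<longleftrightarrow> (\<forall>R H. r < R \<longrightarrow> H holomorphic_on ball 0 R \<longrightarrow>
     (\<forall>s. norm s = r \<longrightarrow> u (z + s *s c) \<le> ereal (Re (H s))) \<longrightarrow> u z \<le> ereal (Re (H 0)))"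

lemma psh_imp_submean_at:
  assumes "psh u" "0 < r"
  shows "submean_at u z c r"
  unfolding submean_at_def
proof (intro allI impI)
  fix R H assume R: "r < R" and H: "H holomorphic_on ball 0 R"
    and le: "\<forall>s. norm s = r \<longrightarrow> u (z + s *s c) \<le> ereal (Re (H s))"
  have u: "usc u" "\<And>z. u z < \<infinity>" using assms(1) by (auto simp: psh_def usc_def)
  have "continuous_on (sphere 0 r) H"
    by (rule holomorphic_on_imp_continuous_on[OF holomorphic_on_subset[OF H]]) (use R in auto)
  then have "bounded (H ` sphere 0 r)"
    by (intro compact_imp_bounded compact_continuous_image) auto
  then obtain M where M: "\<And>s. norm s = r \<Longrightarrow> norm (H s) \<le> M" by (metis bounded_iff image_eqI mem_sphere_0)
  \<comment> \<open>The level exceeds |H| on the circle, so truncating at \<open>-n\<close> does not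
    lift \<open>u\<close> above the majorant \<open>Re H\<close>. One such truncated mean already
    bounds the infimum \<open>circle_mean\<close>.\<close>
  obtain n :: nat where n: "M \<le> real n" using real_arch_simple by blast
  let ?f = "\<lambda>t. u (z + cis t *s (of_real r *s c))"
  have f: "?f t \<le> ereal (Re (H (of_real r * cis t)))" for t
    using le[rule_format, of "of_real r * cis t"] assms(2)
    by (simp add: norm_mult vector_scalar_mult_def mult_ac)
  have "usc ?f"
    by (rule usc_compose[OF u(1)]) (auto intro!: continuous_intros continuous_on_cis)
  then have int: "(\<lambda>t. real_of_ereal (max (?f t) (- ereal n))) integrable_on {0..2*pi}"
    using usc_bounded_integrable u(2) by blast
  note mv = holomorphic_mean_value[OF H assms(2) R]
  have "integral {0..2*pi} (\<lambda>t. real_of_ereal (max (?f t) (- ereal n))) \<le> 2 * pi * Re (H 0)"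
  proof (rule has_integral_le[OF integrable_integral[OF int] mv])
    fix t
    have "- real n \<le> Re (H (of_real r * cis t))"
      using M[of "of_real r * cis t"] n assms(2) abs_Re_le_cmod[of "H (of_real r * cis t)"]
      by (simp add: norm_mult)
    then have "max (?f t) (- ereal n) \<le> ereal (Re (H (of_real r * cis t)))"
      using f[of t] by simp
    then show "real_of_ereal (max (?f t) (- ereal n)) \<le> Re (H (of_real r * cis t))"
      by (cases "?f t") (auto simp: max_def split: if_splits)
  qed
  then have "integral {0..2*pi} (\<lambda>t. real_of_ereal (max (?f t) (- ereal n))) / (2*pi) \<le> Re (H 0)"
    by (simp add: field_simps)
  moreover have "u z \<le> circle_mean u z (of_real r *s c)" using assms(1) by (simp add: psh_def)
  moreover have "circle_mean u z (of_real r *s c) \<le>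
    ereal (integral {0..2*pi} (\<lambda>t. real_of_ereal (max (?f t) (- ereal n))) / (2*pi))"
    unfolding circle_mean_def by (rule INF_lower) simp
  ultimately show "u z \<le> ereal (Re (H 0))" by (meson ereal_less_eq(3) order_trans)
qed


text \<open>On the unit circle \<open>cnj x\<close> is \<open>1 / x\<close>, so the product is a
  Laurent polynomial, and \<open>c / x^n\<close> has the same real part as
  \<open>cnj c * x^n\<close>.\<close>

lemma Re_poly_mult_cnj_on_circle:
  "\<exists>r. \<forall>x. norm x = 1 \<longrightarrow> Re (poly p x * cnj (poly q x)) = Re (poly r x)"
proof (induction p arbitrary: q)
  case 0
  show ?case by (intro exI[of _ 0]) simp
next
  case (pCons a p)
  obtain b q' where q: "q = pCons b q'" by (cases q)
  obtain r where r: "\<And>x. norm x = 1 \<Longrightarrow> Re (poly p x * cnj (poly q' x)) = Re (poly r x)"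
    using pCons.IH by blast
  let ?r = "[:a * cnj b:] + smult (cnj a) (pCons 0 q') + smult (cnj b) (pCons 0 p) + r"
  have "Re (poly (pCons a p) x * cnj (poly q x)) = Re (poly ?r x)" if x: "norm x = 1" for x
  proof -
    have "x * cnj x = 1" using x by (simp add: complex_norm_square[symmetric])
    then have "poly (pCons a p) x * cnj (poly q x) = a * cnj b + a * cnj (x * poly q' x) +
        x * poly p x * cnj b + poly p x * cnj (poly q' x)"
      unfolding q by (simp add: algebra_simps)
    moreover have "Re (a * cnj (x * poly q' x)) = Re (cnj a * (x * poly q' x))"
      by (metis complex_cnj_cnj complex_cnj_mult cnj.simps(1))
    ultimately show ?thesis using r[OF x] by (simp add: algebra_simps)
  qed
  then show ?case by blast
qed

text \<open>Stone-Weierstrass for the real parts of polynomials. They are closed under products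
  because \<open>Re a * Re b\<close> is half the real part of \<open>a * b + a * cnj b\<close>, and
  \<open>Re\<close> and \<open>Im\<close> separate points.\<close>

lemma Re_poly_dense_on_circle:
  fixes g :: "complex \<Rightarrow> real"
  assumes "continuous_on (sphere 0 1) g" "0 < e"
  shows "\<exists>p. \<forall>x\<in>sphere 0 1. \<bar>g x - Re (poly p x)\<bar> < e"
proof -
  let ?P = "\<lambda>g. \<exists>p. \<forall>x\<in>sphere 0 1. g x = Re (poly p x)"
  have "\<exists>h. ?P h \<and> (\<forall>x\<in>sphere 0 1. \<bar>g x - h x\<bar> < e)"
  proof (rule Stone_Weierstrass_HOL[OF _ _ _ _ _ _ assms])
    show "compact (sphere (0::complex) 1)" by simp
    show "?P (\<lambda>x. c)" for c by (intro exI[of _ "[:of_real c:]"]) simp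
    show "continuous_on (sphere 0 1) f" if "?P f" for f
    proof -
      obtain p where "\<forall>x\<in>sphere 0 1. f x = Re (poly p x)" using \<open>?P f\<close> by blast
      moreover have "continuous_on (sphere 0 1) (\<lambda>x. Re (poly p x))" by (intro continuous_intros)
      ultimately show ?thesis by (metis (no_types, lifting) continuous_on_cong)
    qed
    show "?P (\<lambda>x. f x + h x)" if fh: "?P f \<and> ?P h" for f h
    proof -
      obtain p q where "\<forall>x\<in>sphere 0 1. f x = Re (poly p x)" "\<forall>x\<in>sphere 0 1. h x = Re (poly q x)" using fh by blast
      then show ?thesis by (intro exI[of _ "p + q"]) simp
    qed
    show "?P (\<lambda>x. f x * h x)" if fh: "?P f \<and> ?P h" for f h
    proof -
      obtain p q where pq: "\<forall>x\<in>sphere 0 1. f x = Re (poly p x)" "\<forall>x\<in>sphere 0 1. h x = Re (poly q x)" using fh by blast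
      obtain r where r: "\<And>x. norm x = 1 \<Longrightarrow> Re (poly p x * cnj (poly q x)) = Re (poly r x)"
        using Re_poly_mult_cnj_on_circle by blast
      have "f x * h x = Re (poly (smult (1/2) (p * q + r)) x)" if "x \<in> sphere 0 1" for x
      proof -
        have "Re (poly p x) * Re (poly q x) = (Re (poly p x * poly q x) + Re (poly p x * cnj (poly q x))) / 2"
          by (simp add: field_simps)
        then show ?thesis using pq that r[of x] by simp
      qed
      then show ?thesis by blast
    qed
    show "\<exists>f. ?P f \<and> f x \<noteq> f y" if "x \<in> sphere 0 1 \<and> y \<in> sphere 0 1 \<and> x \<noteq> y" for x y :: complex
    proof (cases "Re x = Re y")
      case False
      then show ?thesis by (intro exI[of _ Re] conjI exI[of _ "[:0, 1:]"]) auto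
    next
      case True
      then have "Im x \<noteq> Im y" using that complex_eqI by blast
      then show ?thesis by (intro exI[of _ Im] conjI exI[of _ "[:0, -\<i>:]"]) auto
    qed
  qed
  then show ?thesis by fastforce
qed

text \<open>The approximants are the Lipschitz envelopes \<open>x \<mapsto> sup\<^sub>y (f y - k |y - x|)\<close>.\<close>
lemma usc_continuous_approx:
  fixes f :: "'a::metric_space \<Rightarrow> real"
  assumes usc: "\<And>x y. x \<in> S \<Longrightarrow> f x < y \<Longrightarrow> \<exists>d>0. \<forall>x'\<in>S. dist x' x < d \<longrightarrow> f x' < y"
    and bd: "\<And>x. x \<in> S \<Longrightarrow> \<bar>f x\<bar> \<le> M"
  obtains g :: "nat \<Rightarrow> 'a \<Rightarrow> real"
  where "\<And>k. continuous_on S (g k)" "\<And>k x. x \<in> S \<Longrightarrow> f x \<le> g k x"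
    "\<And>k x. x \<in> S \<Longrightarrow> \<bar>g k x\<bar> \<le> M" "\<And>x. x \<in> S \<Longrightarrow> (\<lambda>k. g k x) \<longlonglongrightarrow> f x"
proof
  let ?g = "\<lambda>(k::nat) x. SUP y\<in>S. f y - real k * dist y x"
  have le: "f y - real k * dist y x \<le> M" if "y \<in> S" for y x k
  proof -
    have "0 \<le> real k * dist y x" by simp
    then show ?thesis using bd[OF that] by linarith
  qed
  then have bdd: "bdd_above ((\<lambda>y. f y - real k * dist y x) ` S)" for k x
    by (auto simp: bdd_above_def)
  show ge: "f x \<le> ?g k x" if "x \<in> S" for k x
    using cSUP_upper[OF that bdd[of k x]] by simp
  show "\<bar>?g k x\<bar> \<le> M" if "x \<in> S" for k x
  proof -
    have "?g k x \<le> M" by (rule cSUP_least) (use that le in auto)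
    moreover have "-M \<le> ?g k x" using ge[OF that, of k] bd[OF that] by linarith
    ultimately show ?thesis by linarith
  qed
  show "continuous_on S (?g k)" for k
  proof (rule lipschitz_on_continuous_on[OF lipschitz_onI])
    have *: "?g k x \<le> ?g k y + real k * dist x y" if "x \<in> S" for x y
    proof (rule cSUP_least)
      fix z assume z: "z \<in> S"
      have "real k * dist z y \<le> real k * dist z x + real k * dist x y"
        by (metis dist_triangle distrib_left mult_left_mono of_nat_0_le_iff)
      moreover have "f z - real k * dist z y \<le> ?g k y" by (rule cSUP_upper[OF z bdd])
      ultimately show "f z - real k * dist z x \<le> ?g k y + real k * dist x y" by linarith
    qed (use that in auto)
    show "dist (?g k x) (?g k y) \<le> real k * dist x y" if "x \<in> S" "y \<in> S" for x y
      using *[OF that(1), of y] *[OF that(2), of x] by (simp add: dist_real_def dist_commute abs_le_iff)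
  qed simp
  show "(\<lambda>k. ?g k x) \<longlonglongrightarrow> f x" if x: "x \<in> S" for x
  proof (rule order_tendstoI)
    show "\<forall>\<^sub>F k in sequentially. a < ?g k x" if "a < f x" for a
      using ge[OF x] that by (intro always_eventually allI) (meson less_le_trans)
    show "\<forall>\<^sub>F k in sequentially. ?g k x < a" if "f x < a" for a
    proof -
      define b where "b = (f x + a) / 2"
      have b: "f x < b" "b < a" using that by (auto simp: b_def)
      obtain d where d: "d > 0" "\<And>x'. x' \<in> S \<Longrightarrow> dist x' x < d \<Longrightarrow> f x' < b"
        using usc[OF x b(1)] by blast
      \<comment> \<open>From this slope on, points at distance at least \<open>d\<close> are
        penalised by at least \<open>M - b\<close>, so they contribute at most \<open>b\<close> to
        the supremum.\<close>
      obtain N :: nat where N: "(M - b) / d \<le> real N" using real_arch_simple by blast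
      have "?g k x < a" if "N \<le> k" for k
      proof -
        have "?g k x \<le> b"
        proof (rule cSUP_least)
          fix y assume y: "y \<in> S"
          show "f y - real k * dist y x \<le> b"
          proof (cases "dist y x < d")
            case True
            have "0 \<le> real k * dist y x" by simp
            then show ?thesis using d(2)[OF y True] by linarith
          next
            case False
            have "(M - b) / d \<le> real k" using N that by linarith
            then have "M - b \<le> real k * d" using d(1) by (simp add: field_simps)
            also have "\<dots> \<le> real k * dist y x" using False by (intro mult_left_mono) auto
            finally show ?thesis using bd[OF y] by linarith
          qed
        qed (use x in auto)
        then show ?thesis using b by linarith
      qed
      then show ?thesis using eventually_sequentially by blast
    qed
  qed
qed

text \<open>Strict majorants \<open>Re p\<close> with polynomial \<open>p\<close> suffice:
  continuous majorants of a truncation converge to it pointwise, each is uniformly approximated on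
  the circle by such real parts, and dominated convergence recovers the circle mean. Strictness
  later makes the premise of \<open>sub\<close> stable under moving the centre.\<close>

lemma psh_if_submean:
  assumes usc: "usc u" and fin: "\<And>z. u z < \<infinity>"
    and sub: "\<And>a b p. (\<And>s. norm s = 1 \<Longrightarrow> u (a + s *s b) < ereal (Re (poly p s))) \<Longrightarrow> u a \<le> ereal (Re (poly p 0))"
  shows "psh u"
  unfolding psh_def
proof (intro conjI allI)
  show "open {z. u z < c}" for c using usc by (rule uscD)
  fix a b :: "complex^'a"
  show "u a \<le> circle_mean u a b"
    unfolding circle_mean_def
  proof (rule INF_greatest)
    fix n :: nat
    let ?f = "\<lambda>s. real_of_ereal (max (u (a + s *s b)) (- ereal n))"
    let ?S = "sphere (0::complex) 1"
    have eq: "ereal (?f s) = max (u (a + s *s b)) (- ereal n)" for s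
      using fin[of "a + s *s b"] by (cases "u (a + s *s b)") (auto simp: max_def)
    have uscs: "usc (\<lambda>s. u (a + s *s b))"
      by (rule usc_compose[OF usc]) (intro continuous_intros)
    obtain s0 where s0: "\<And>s. s \<in> ?S \<Longrightarrow> u (a + s *s b) \<le> u (a + s0 *s b)"
      using usc_attains_max[OF uscs, of ?S] by auto
    have bd: "\<bar>?f s\<bar> \<le> max \<bar>?f s0\<bar> (real n)" if "s \<in> ?S" for s
    proof -
      have "ereal (?f s) \<le> ereal (?f s0)" "ereal (-n) \<le> ereal (?f s)"
        unfolding eq using s0[OF that] by (auto simp: max.coboundedI1)
      then have "?f s \<le> ?f s0" "-n \<le> ?f s" by (simp_all only: ereal_less_eq)
      then show ?thesis by arith
    qed
    have lsc: "\<exists>d>0. \<forall>s'\<in>?S. dist s' s < d \<longrightarrow> ?f s' < y" if "?f s < y" for s y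
    proof -
      have *: "?f s < y \<longleftrightarrow> u (a + s *s b) < ereal y \<and> - real n < y" for s
        unfolding less_ereal.simps(1)[of "?f s" y, symmetric] eq by auto
      have "open {s. u (a + s *s b) < ereal y}" by (rule uscD[OF uscs])
      moreover have "s \<in> {s. u (a + s *s b) < ereal y}" using that * by blast
      ultimately obtain d where "d > 0" "ball s d \<subseteq> {s. u (a + s *s b) < ereal y}"
        unfolding open_contains_ball by blast
      then have "\<forall>s'\<in>?S. dist s' s < d \<longrightarrow> ?f s' < y"
        using * that by (auto simp: subset_iff dist_commute)
      then show ?thesis using \<open>d > 0\<close> by blast
    qed
    obtain g :: "nat \<Rightarrow> complex \<Rightarrow> real" where g: "\<And>k. continuous_on ?S (g k)" "\<And>k x. x \<in> ?S \<Longrightarrow> ?f x \<le> g k x"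
      "\<And>k x. x \<in> ?S \<Longrightarrow> \<bar>g k x\<bar> \<le> max \<bar>?f s0\<bar> (real n)" "\<And>x. x \<in> ?S \<Longrightarrow> (\<lambda>k. g k x) \<longlonglongrightarrow> ?f x"
      using usc_continuous_approx[of ?S ?f "max \<bar>?f s0\<bar> (real n)"] lsc bd by blast
    have gc: "continuous_on {0..2*pi} (\<lambda>t. g k (cis t))" for k
      by (rule continuous_on_compose2[OF g(1)]) (auto intro!: continuous_on_cis continuous_intros)
    have lim: "(\<lambda>k. integral {0..2*pi} (\<lambda>t. g k (cis t))) \<longlonglongrightarrow> integral {0..2*pi} (\<lambda>t. ?f (cis t))"
      by (rule dominated_convergence(2)[where h = "\<lambda>_. max \<bar>?f s0\<bar> (real n)"])
         (use g gc in \<open>auto intro!: integrable_continuous_interval\<close>)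
    have key: "u a \<le> ereal (integral {0..2*pi} (\<lambda>t. g k (cis t)) / (2*pi) + 2 * e)" if "e > 0" for k e
    proof -
      \<comment> \<open>Approximating \<open>g k + e\<close> within \<open>e\<close> puts
        \<open>Re p\<close> strictly between \<open>g k\<close> and
        \<open>g k + 2 * e\<close>.\<close>
      obtain p where p: "\<And>x. x \<in> ?S \<Longrightarrow> \<bar>(g k x + e) - Re (poly p x)\<bar> < e"
        using Re_poly_dense_on_circle[OF continuous_on_add[OF g(1)[of k] continuous_on_const] \<open>e > 0\<close>]
        by blast
      have "u a \<le> ereal (Re (poly p 0))"
      proof (rule sub)
        fix s :: complex assume s: "norm s = 1"
        have "?f s < Re (poly p s)" using g(2)[of s k] p[of s] s by simp
        then have "ereal (?f s) < ereal (Re (poly p s))" by simp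
        then show "u (a + s *s b) < ereal (Re (poly p s))" unfolding eq by simp
      qed
      also have "Re (poly p 0) \<le> integral {0..2*pi} (\<lambda>t. g k (cis t)) / (2*pi) + 2 * e"
      proof -
        have "((\<lambda>t. Re (poly p (of_real 1 * cis t))) has_integral (2 * pi * Re (poly p 0))) {0..2*pi}"
          by (rule holomorphic_mean_value[of _ 2]) (auto intro!: holomorphic_intros)
        moreover have "((\<lambda>t. g k (cis t) + 2 * e) has_integral (integral {0..2*pi} (\<lambda>t. g k (cis t)) + (2*pi) * (2 * e))) {0..2*pi}"
          using has_integral_add[OF integrable_integral[OF integrable_continuous_interval[OF gc[of k]]] has_integral_const_real[of "2*e" 0 "2*pi"]]
          by simp
        ultimately have "2 * pi * Re (poly p 0) \<le> integral {0..2*pi} (\<lambda>t. g k (cis t)) + (2*pi) * (2 * e)"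
        proof (rule has_integral_le)
          fix t show "Re (poly p (of_real 1 * cis t)) \<le> g k (cis t) + 2 * e"
            using p[of "cis t"] by simp
        qed
        then show ?thesis by (simp add: field_simps)
      qed
      finally show ?thesis by simp
    qed
    have key2: "u a \<le> ereal (integral {0..2*pi} (\<lambda>t. ?f (cis t)) / (2*pi) + 2 * e)" if "e > 0" for e
    proof (rule LIMSEQ_le_const)
      show "(\<lambda>k. ereal (integral {0..2*pi} (\<lambda>t. g k (cis t)) / (2*pi) + 2 * e)) \<longlonglongrightarrow> ereal (integral {0..2*pi} (\<lambda>t. ?f (cis t)) / (2*pi) + 2 * e)"
        by (intro tendsto_intros lim) simp
    qed (use key that in blast)
    show "u a \<le> ereal (integral {0..2 * pi} (\<lambda>t. real_of_ereal (max (u (a + cis t *s b)) (- ereal (real n)))) / (2 * pi))"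
    proof (rule ereal_le_epsilon2)
      fix e :: real assume "0 < e"
      then show "u a \<le> ereal (integral {0..2 * pi} (\<lambda>t. ?f (cis t)) / (2 * pi)) + ereal e"
        using key2[of "e/2"] by simp
    qed
  qed
qed (use fin in auto)

subsection \<open>Doubling of variables\<close>

lemma holomorphic_second_order_bound:
  assumes h: "h holomorphic_on UNIV" and "h 0 = 0" "deriv h 0 = 0"
  obtains C where "C \<ge> 0" "\<And>s. norm s \<le> 1 \<Longrightarrow> norm (h s) \<le> C * (norm s)\<^sup>2"
proof -
  have h1: "deriv h holomorphic_on UNIV" using h by (simp add: holomorphic_deriv)
  have h2: "deriv (deriv h) holomorphic_on UNIV" using h1 by (simp add: holomorphic_deriv)
  have "bounded (deriv (deriv h) ` cball 0 1)"
    by (intro compact_imp_bounded compact_continuous_image holomorphic_on_imp_continuous_on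
        holomorphic_on_subset[OF h2]) auto
  then obtain B where "\<forall>y \<in> deriv (deriv h) ` cball 0 1. norm y \<le> B" unfolding bounded_iff by blast
  then have B: "norm (deriv (deriv h) s) \<le> B" if "s \<in> cball 0 1" for s using that by blast
  have "norm (h s) \<le> B * (norm s)\<^sup>2" if s: "norm s \<le> 1" for s
  proof -
    have "norm ((deriv ^^ 0) h s - (\<Sum>i\<le>1. (deriv ^^ i) h 0 * (s - 0) ^ i / fact i)) \<le> B * norm (s - 0) ^ Suc 1 / fact 1"
    proof (rule field_Taylor[where S = "cball 0 1" and f = "\<lambda>i. (deriv ^^ i) h"])
      fix i :: nat and x :: complex
      assume "i \<le> 1"
      then have "(deriv ^^ i) h holomorphic_on UNIV" using h h1 by (cases i) auto
      then show "((deriv ^^ i) h has_field_derivative (deriv ^^ Suc i) h x) (at x within cball 0 1)"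
        by (simp add: holomorphic_derivI[of _ UNIV])
    qed (use B s in auto)
    then show ?thesis using assms by (simp add: power2_eq_square)
  qed
  moreover have "0 \<le> B" using B[of 0] norm_ge_zero[of "deriv (deriv h) 0"] by (simp del: norm_ge_zero)
  ultimately show ?thesis using that by blast
qed

lemma norm_sq_vec: "(norm (x :: complex^'n))\<^sup>2 = (\<Sum>i\<in>UNIV. (norm (x $ i))\<^sup>2)"
  by (simp add: norm_vec_def L2_set_def sum_nonneg)

text \<open>The conjugate sits on the fixed vector \<open>d\<close>: when \<open>h\<close> depends
  holomorphically on a parameter, the cross term is the real part of a holomorphic function and can
  be absorbed into a harmonic majorant.\<close>

lemma norm_add_sq_vec:
  fixes d h :: "complex^'n"
  shows "(norm (d + h))\<^sup>2 = (norm d)\<^sup>2 + 2 * Re (\<Sum>i\<in>UNIV. h $ i * cnj (d $ i)) + (norm h)\<^sup>2"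
proof -
  have "(norm (a + b))\<^sup>2 = (norm a)\<^sup>2 + 2 * Re (b * cnj a) + (norm b)\<^sup>2" for a b :: complex
    unfolding cmod_power2 by (simp add: power2_eq_square algebra_simps)
  then show ?thesis
    by (simp add: norm_sq_vec sum.distrib sum_distrib_left Re_sum)
qed

lemma vec_second_order_bound:
  fixes h :: "complex \<Rightarrow> complex^'n"
  assumes "\<And>i. (\<lambda>s. h s $ i) holomorphic_on UNIV" "h 0 = 0" "\<And>i. deriv (\<lambda>s. h s $ i) 0 = 0"
  obtains C where "C \<ge> 0" "\<And>s. norm s \<le> 1 \<Longrightarrow> (norm (h s))\<^sup>2 \<le> C * (norm s)^4"
proof -
  have "\<exists>C\<ge>0. \<forall>s. norm s \<le> 1 \<longrightarrow> norm (h s $ i) \<le> C * (norm s)\<^sup>2" for i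
    using holomorphic_second_order_bound[OF assms(1) _ assms(3)] assms(2) by (metis zero_index)
  then obtain C where C: "\<And>i. C i \<ge> 0" "\<And>i s. norm s \<le> 1 \<Longrightarrow> norm (h s $ i) \<le> C i * (norm s)\<^sup>2"
    by metis
  have "(norm (h s))\<^sup>2 \<le> (\<Sum>i\<in>UNIV. (C i)\<^sup>2) * (norm s)^4" if "norm s \<le> 1" for s
  proof -
    have "(norm (h s))\<^sup>2 \<le> (\<Sum>i\<in>UNIV. (C i * (norm s)\<^sup>2)\<^sup>2)"
      unfolding norm_sq_vec by (intro sum_mono power_mono C that) auto
    then show ?thesis by (simp add: power_mult_distrib sum_distrib_right flip: power_mult)
  qed
  then show ?thesis using that[of "\<Sum>i\<in>UNIV. (C i)\<^sup>2"] by (simp add: sum_nonneg)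
qed

text \<open>Supplies the radius at which the quadratic gain beats the quartic error.
  \<open>K + 1\<close> avoids division by zero, and the factor 1/2 makes the inequality
  strict.\<close>

lemma quartic_less_quadratic:
  fixes K \<delta> r :: real
  assumes "0 \<le> K" "0 < \<delta>" "0 < r" "r \<le> sqrt (\<delta> / (K + 1)) / 2"
  shows "K * r^4 < \<delta> * r\<^sup>2"
proof -
  have pos: "0 < sqrt (\<delta> / (K + 1))" using assms by simp
  then have "r < sqrt (\<delta> / (K + 1))" using assms(4) by linarith
  then have "r\<^sup>2 < (sqrt (\<delta> / (K + 1)))\<^sup>2" using assms(3) by (intro power_strict_mono) auto
  then have "r\<^sup>2 < \<delta> / (K + 1)" using assms by simp
  then have "r\<^sup>2 * (K + 1) < \<delta>" using assms(1) by (simp add: pos_less_divide_eq)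
  moreover have "r\<^sup>2 * (K + 1) = K * r\<^sup>2 + r\<^sup>2" by (simp add: algebra_simps)
  moreover have "0 < r\<^sup>2" using assms(3) by simp
  ultimately have "K * r\<^sup>2 < \<delta>" by linarith
  then have "K * r\<^sup>2 * r\<^sup>2 < \<delta> * r\<^sup>2" using \<open>0 < r\<^sup>2\<close> by (rule mult_strict_right_mono)
  then show ?thesis by (simp add: power4_eq_xxxx power2_eq_square mult_ac)
qed

text \<open>The relation \<open>g z w = 0\<close> acts as a multivalued map from the disc in
  \<open>w\<close> to the points \<open>z\<close>; a graph and a family of fibres are the two
  instances. \<open>dir\<close> is demanded only where \<open>W\<close> is finite, which is where
  the maximum occurs, and \<open>bdd\<close> confines near-solutions of the relation to a
  ball.\<close>

lemma submean_doubling: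
  fixes W :: "complex^'d \<Rightarrow> ereal" and g :: "complex^'d \<Rightarrow> complex \<Rightarrow> complex^'d"
  assumes usc: "usc W" and fin: "\<And>z. W z < \<infinity>"
    and gcont: "continuous_on UNIV (\<lambda>x. g (fst x) (snd x))"
    and ghol: "\<And>z c w i. (\<lambda>s. g (z + s *s c) (w + s) $ i) holomorphic_on UNIV"
    and dir: "\<And>z w. W z \<noteq> -\<infinity> \<Longrightarrow> \<exists>c. (\<forall>i. deriv (\<lambda>s. g (z + s *s c) (w + s) $ i) 0 = 0) \<and>
        (\<exists>r0>0. \<forall>r. 0 < r \<and> r < r0 \<longrightarrow> submean_at W z c r)"
    and bdd: "bounded {z. \<exists>w. norm w \<le> 1 \<and> norm (g z w) \<le> 1}"
    and p: "p holomorphic_on UNIV"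
    and bdry: "\<And>z w. norm w = 1 \<Longrightarrow> g z w = 0 \<Longrightarrow> W z < ereal (Re (p w))"
    and z0: "g z0 0 = 0"
  shows "W z0 \<le> ereal (Re (p 0))"
proof (rule ccontr)
  assume "\<not> ?thesis"
  then have gt: "ereal (Re (p 0)) < W z0" by simp
  then obtain \<omega>0 where \<omega>0: "W z0 = ereal \<omega>0" using fin[of z0] by (cases "W z0") auto
  \<comment> \<open>A third of the gap: then \<open>\<Psi> (z0, 0) = 2 * \<delta>\<close>, still
    above the threshold \<delta> used in \<open>T\<close>.\<close>
  define \<delta> where "\<delta> = (\<omega>0 - Re (p 0)) / 3"
  have "3 * \<delta> = \<omega>0 - Re (p 0)" "Re (p 0) < \<omega>0" using gt \<omega>0 by (simp_all add: \<delta>_def)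
  then have \<delta>: "0 < \<delta>" "\<omega>0 - Re (p 0) - \<delta> > \<delta>" by linarith+
  define q where "q = (\<lambda>w. Re (p w) + \<delta> * (1 - (norm w)\<^sup>2))"
  have pc: "continuous_on UNIV p" using p by (rule holomorphic_on_imp_continuous_on)
  have qc: "continuous_on UNIV q" unfolding q_def by (intro continuous_intros pc)
  obtain R1 where R1: "\<And>z w. norm w \<le> 1 \<Longrightarrow> norm (g z w) \<le> 1 \<Longrightarrow> norm z \<le> R1"
    using bdd unfolding bounded_iff by blast
  \<comment> \<open>Enlarging by 1 makes the bound strict: on the sphere \<open>norm z = R0\<close>
    the norm of \<open>g\<close> exceeds 1.\<close>
  define R0 where "R0 = R1 + 1"
  have R0: "norm z < R0" if "norm w \<le> 1" "norm (g z w) \<le> 1" for z w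
    using R1[OF that] by (simp add: R0_def)
  define S where "S = cball (0::complex^'d) R0 \<times> cball (0::complex) 1"
  have z0S: "(z0, 0) \<in> S" using R0[of 0 z0] z0 by (simp add: S_def)
  have S: "compact S" unfolding S_def by (intro compact_Times compact_cball)
  define G where "G = (\<lambda>x. norm (g (fst x) (snd x)))"
  have Gc: "continuous_on UNIV G" unfolding G_def by (intro continuous_intros gcont)
  have uscW: "usc (\<lambda>x. W (fst x))" by (intro usc_compose[OF usc] continuous_intros)
  have qsc: "continuous_on UNIV (\<lambda>x. q (snd x))"
    by (rule continuous_on_compose2[OF qc]) (auto intro: continuous_intros)
  \<comment> \<open>The boundary points of \<open>S\<close> at which a maximum above \<delta> is
    conceivable. On the face \<open>norm w = 1\<close> by \<open>bdry\<close>, on the other by the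
    choice of \<open>R0\<close>, \<open>g\<close> has no zero in this compact set, so its norm is at
    least some \<gamma> > 0 there.\<close>
  define T where "T = S \<inter> ({x. ereal \<delta> \<le> W (fst x) + ereal (- q (snd x))} \<inter>
    ({x. norm (snd x) = 1} \<union> {x. norm (fst x) = R0}))"
  have "compact T" unfolding T_def
  proof (rule compact_Int_closed[OF S], intro closed_Int closed_Un)
    show "closed {x. ereal \<delta> \<le> W (fst x) + ereal (- q (snd x))}"
      by (intro usc_closed_ge usc_add uscW usc_continuous continuous_intros qsc) (use fin in simp_all)
    show "closed {x::(complex^'d) \<times> complex. norm (snd x) = 1}" "closed {x::(complex^'d) \<times> complex. norm (fst x) = R0}"
      by (intro closed_Collect_eq continuous_intros)+
  qed
  moreover have Tpos: "G x > 0" if "x \<in> T" for x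
  proof (rule ccontr)
    assume "\<not> G x > 0"
    then have g0: "g (fst x) (snd x) = 0" by (simp add: G_def)
    from that have x: "norm (snd x) \<le> 1" "ereal \<delta> \<le> W (fst x) + ereal (- q (snd x))"
      "norm (snd x) = 1 \<or> norm (fst x) = R0"
      by (auto simp: T_def S_def)
    have "norm (fst x) \<noteq> R0" using R0[of "snd x" "fst x"] g0 x(1) by simp
    then have n1: "norm (snd x) = 1" using x(3) by blast
    then have "W (fst x) < ereal (q (snd x))" using bdry[OF n1 g0] by (simp add: q_def)
    then show False using x(2) \<delta>(1) by (cases "W (fst x)") auto
  qed
  ultimately have "\<exists>\<gamma>>0. \<forall>x\<in>T. \<gamma> \<le> G x"
  proof (cases "T = {}")
    case False
    then obtain x0 where "x0 \<in> T" "\<forall>x\<in>T. G x0 \<le> G x"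
      using continuous_attains_inf[OF \<open>compact T\<close> _ continuous_on_subset[OF Gc]] by blast
    then show ?thesis using Tpos by blast
  qed (auto intro: exI[of _ 1])
  then obtain \<gamma> where \<gamma>: "0 < \<gamma>" "\<And>x. x \<in> T \<Longrightarrow> \<gamma> \<le> G x" by blast
  have "cball (0::complex^'d) R0 \<noteq> {}" using z0S unfolding S_def by blast
  then obtain zm where zm: "\<And>z. z \<in> cball 0 R0 \<Longrightarrow> W z \<le> W zm"
    using usc_attains_max[OF usc compact_cball] by metis
  have "W z0 \<le> W zm" using zm z0S by (simp add: S_def)
  then obtain Mw where Mw: "W zm = ereal Mw" using \<omega>0 fin[of zm] by (cases "W zm") auto
  have "cball (0::complex) 1 \<noteq> {}" by simp
  then obtain wm where wm: "\<And>w. w \<in> cball 0 1 \<Longrightarrow> q wm \<le> q w"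
    using continuous_attains_inf[OF compact_cball _ continuous_on_subset[OF qc subset_UNIV]] by blast
  \<comment> \<open>With this weight the penalty on \<open>T\<close> is at least the largest
    possible value of \<open>W - q\<close> on \<open>S\<close>, so \<Psi> is at most 0 on
    \<open>T\<close>.\<close>
  obtain k0 :: nat where k0: "(Mw - q wm) / \<gamma>\<^sup>2 \<le> real k0" using real_arch_simple by blast
  define k where "k = real k0"
  have k: "0 \<le> k" "Mw - q wm \<le> k * \<gamma>\<^sup>2" using k0 \<gamma>(1) by (simp_all add: k_def field_simps)
  define \<Psi> where "\<Psi> = (\<lambda>x. W (fst x) + ereal (- q (snd x) - k * (G x)\<^sup>2))"
  have "usc \<Psi>" unfolding \<Psi>_def
    by (intro usc_add uscW usc_continuous continuous_intros qsc Gc) (use fin in simp_all)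
  then obtain x where xS: "x \<in> S" and xmax: "\<And>y. y \<in> S \<Longrightarrow> \<Psi> y \<le> \<Psi> x"
    using usc_attains_max[OF _ S, of \<Psi>] z0S by blast
  obtain z w where x: "x = (z, w)" by (cases x)
  have "\<Psi> (z0, 0) = ereal (\<omega>0 - q 0)" by (simp add: \<Psi>_def \<omega>0 G_def z0)
  moreover have "\<omega>0 - q 0 > \<delta>" using \<delta> by (simp add: q_def)
  ultimately have \<Psi>x: "ereal \<delta> < \<Psi> x" using xmax[OF z0S] by (metis less_ereal.simps(1) less_le_trans)
  then obtain \<omega> where \<omega>: "W z = ereal \<omega>" using fin[of z] by (cases "W z") (auto simp: \<Psi>_def x)
  have \<Psi>x': "\<Psi> x = ereal (\<omega> - q w - k * (G x)\<^sup>2)" by (simp add: \<Psi>_def x \<omega>)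
  have zw: "norm z \<le> R0" "norm w \<le> 1" using xS by (auto simp: S_def x)
  \<comment> \<open>The maximiser satisfies the inequality \<open>\<delta> \<le> W - q\<close> from
    the definition of \<open>T\<close>, so lying outside \<open>T\<close> puts it in the interior of
    \<open>S\<close>.\<close>
  have "x \<notin> T"
  proof
    assume "x \<in> T"
    then have "\<gamma>\<^sup>2 \<le> (G x)\<^sup>2" using \<gamma> by (intro power_mono) auto
    then have "k * \<gamma>\<^sup>2 \<le> k * (G x)\<^sup>2" using k(1) by (rule mult_left_mono)
    moreover have "\<omega> \<le> Mw" using zm[of z] zw \<omega> Mw by simp
    moreover have "q wm \<le> q w" using wm zw by simp
    ultimately have "\<omega> - q w - k * (G x)\<^sup>2 \<le> 0" using k(2) by linarith
    then show False using \<Psi>x \<Psi>x' \<delta>(1) by simp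
  qed
  moreover have "\<delta> \<le> \<omega> - q w"
  proof -
    have "0 \<le> k * (G x)\<^sup>2" using k(1) by simp
    then show ?thesis using \<Psi>x \<Psi>x' by simp
  qed
  ultimately have "norm w \<noteq> 1" "norm z \<noteq> R0" using xS by (auto simp: T_def x \<omega>)
  then have zw': "norm z < R0" "norm w < 1" using zw by auto
  obtain c r0 where c: "\<And>i. deriv (\<lambda>s. g (z + s *s c) (w + s) $ i) 0 = 0"
    and r0: "r0 > 0" "\<And>r. 0 < r \<Longrightarrow> r < r0 \<Longrightarrow> submean_at W z c r"
    using dir[of z w] \<omega> by auto
  define h where "h = (\<lambda>s. g (z + s *s c) (w + s) - g z w)"
  have hhol: "(\<lambda>s. h s $ i) holomorphic_on UNIV" for i
    unfolding h_def by (simp, intro holomorphic_intros ghol)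
  have "deriv (\<lambda>s. h s $ i) 0 = 0" for i
    unfolding h_def using c[of i] holomorphic_on_imp_differentiable_at[OF ghol open_UNIV, of 0 z c w i]
    by (simp add: deriv_diff)
  moreover have h0: "h 0 = 0" by (simp add: h_def)
  ultimately obtain C where C: "C \<ge> 0" "\<And>s. norm s \<le> 1 \<Longrightarrow> (norm (h s))\<^sup>2 \<le> C * (norm s)^4"
    using vec_second_order_bound[OF hhol] by blast
  \<comment> \<open>In order: the submean inequality holds at radius \<open>r\<close>; the estimate
    of \<open>h\<close> applies; \<open>w + s\<close> stays in the disc; \<open>z + s *s c\<close>
    stays in the ball; the quartic error is below the quadratic gain.\<close>
  define r where "r = Min {r0 / 2, 1, 1 - norm w, (R0 - norm z) / (norm c + 1), sqrt (\<delta> / (k * C + 1)) / 2}"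
  have kC: "0 \<le> k * C" using k C by simp
  have cpos: "0 < norm c + 1" using norm_ge_zero[of c] by linarith
  have "0 < r" unfolding r_def
    using r0(1) zw' cpos \<delta>(1) kC by (subst Min_gr_iff) auto
  have rle: "r \<le> r0 / 2" "r \<le> 1" "r \<le> 1 - norm w" "r \<le> (R0 - norm z) / (norm c + 1)" "r \<le> sqrt (\<delta> / (k * C + 1)) / 2"
    unfolding r_def by (rule Min_le; simp)+
  have rc: "r * norm c \<le> R0 - norm z"
  proof -
    have "r * (norm c + 1) \<le> R0 - norm z" using rle(4) cpos by (simp add: field_simps)
    then show ?thesis using \<open>0 < r\<close> by (simp add: algebra_simps)
  qed
  have rd: "k * C * r^4 < \<delta> * r\<^sup>2"
    by (rule quartic_less_quadratic[OF kC \<delta>(1) \<open>0 < r\<close> rle(5)])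
  \<comment> \<open>Solve \<open>\<Psi> (z + s *s c, w + s) \<le> \<Psi> x\<close> for
    \<open>W\<close>, with \<open>norm s\<close> replaced by \<open>r\<close> and
    \<open>(norm (h s))\<^sup>2\<close> by its bound \<open>C * r^4\<close>: what remains is the
    real part of a holomorphic function. At \<open>s = 0\<close> it is
    \<open>\<omega> - \<delta> * r\<^sup>2 + k * C * r^4\<close>, which is less than
    \<open>\<omega>\<close>.\<close>
  define H where "H = (\<lambda>s. p (w + s) + of_real \<delta> * (of_real (1 - (norm w)\<^sup>2 - r\<^sup>2) - 2 * (cnj w * s)) +
     of_real (2 * k) * (\<Sum>i\<in>UNIV. h s $ i * cnj (g z w $ i)) + of_real (k * C * r^4 + \<omega> - q w))"
  have "(\<lambda>s. w + s) holomorphic_on UNIV" by (intro holomorphic_intros)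
  then have "(\<lambda>s. p (w + s)) holomorphic_on UNIV"
    using holomorphic_on_compose_gen[OF _ p] by (simp add: o_def)
  then have "H holomorphic_on UNIV" unfolding H_def
    by (intro holomorphic_on_add holomorphic_on_mult holomorphic_on_diff holomorphic_on_sum
        holomorphic_on_const holomorphic_on_ident hhol)
  then have Hhol: "H holomorphic_on ball 0 r0" by (rule holomorphic_on_subset) simp
  have le: "W (z + s *s c) \<le> ereal (Re (H s))" if s: "norm s = r" for s
  proof -
    have "norm (z + s *s c) \<le> R0"
      using norm_triangle_ineq[of z "s *s c"] rc s by (simp add: norm_vector_smult)
    moreover have "norm (w + s) \<le> 1" using norm_triangle_ineq[of w s] s rle(3) by simp
    ultimately have "\<Psi> (z + s *s c, w + s) \<le> \<Psi> x" by (intro xmax) (simp add: S_def)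
    then have 1: "W (z + s *s c) \<le> ereal (\<omega> - q w - k * (G x)\<^sup>2 + q (w + s) + k * (G (z + s *s c, w + s))\<^sup>2)"
      unfolding \<Psi>x' by (cases "W (z + s *s c)") (auto simp: \<Psi>_def)
    have "g (z + s *s c) (w + s) = g z w + h s" by (simp add: h_def)
    then have "(G (z + s *s c, w + s))\<^sup>2 = (G x)\<^sup>2 + 2 * Re (\<Sum>i\<in>UNIV. h s $ i * cnj (g z w $ i)) + (norm (h s))\<^sup>2"
      using norm_add_sq_vec[of "g z w" "h s"] by (simp add: G_def x)
    also have "\<dots> \<le> (G x)\<^sup>2 + 2 * Re (\<Sum>i\<in>UNIV. h s $ i * cnj (g z w $ i)) + C * r^4"
      using C(2)[of s] s rle(2) by simp
    finally have "k * (G (z + s *s c, w + s))\<^sup>2 \<le> k * ((G x)\<^sup>2 + 2 * Re (\<Sum>i\<in>UNIV. h s $ i * cnj (g z w $ i)) + C * r^4)"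
      using k(1) by (rule mult_left_mono)
    moreover have "(norm (w + s))\<^sup>2 = (norm w)\<^sup>2 + 2 * Re (cnj w * s) + r\<^sup>2"
      unfolding s[symmetric] cmod_power2 by (simp add: power2_eq_square algebra_simps)
    then have "q (w + s) = Re (p (w + s)) + \<delta> * (1 - (norm w)\<^sup>2 - r\<^sup>2 - 2 * Re (cnj w * s))"
      by (simp add: q_def algebra_simps)
    moreover have "Re (H s) = Re (p (w + s)) + \<delta> * (1 - (norm w)\<^sup>2 - r\<^sup>2 - 2 * Re (cnj w * s)) +
       2 * k * Re (\<Sum>i\<in>UNIV. h s $ i * cnj (g z w $ i)) + (k * C * r^4 + \<omega> - q w)"
      unfolding H_def by simp
    ultimately have "\<omega> - q w - k * (G x)\<^sup>2 + q (w + s) + k * (G (z + s *s c, w + s))\<^sup>2 \<le> Re (H s)"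
      by (simp add: algebra_simps)
    then show ?thesis using 1 by (meson ereal_less_eq(3) order_trans)
  qed
  have "r < r0" using r0(1) rle(1) by linarith
  then have "submean_at W z c r" using r0(2) \<open>0 < r\<close> by blast
  then have "W z \<le> ereal (Re (H 0))"
    unfolding submean_at_def using Hhol le \<open>r < r0\<close> by blast
  then have "\<omega> \<le> Re (p w) + \<delta> * (1 - (norm w)\<^sup>2 - r\<^sup>2) + (k * C * r^4 + \<omega> - q w)"
    by (simp add: \<omega> H_def h0)
  then have "\<delta> * r\<^sup>2 \<le> k * C * r^4" by (simp add: q_def algebra_simps)
  then show False using rd by simp
qed

subsection \<open>Polynomial maps\<close>

text \<open>Polynomial functions by closure rules instead of coefficients, so that continuity,
  holomorphy and gradients follow by structural induction.\<close>

inductive polyf :: "(complex^'d \<Rightarrow> complex) \<Rightarrow> bool" where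
  const: "polyf (\<lambda>z. c)"
| coord: "polyf (\<lambda>z. z $ i)"
| add: "polyf p \<Longrightarrow> polyf q \<Longrightarrow> polyf (\<lambda>z. p z + q z)"
| mult: "polyf p \<Longrightarrow> polyf q \<Longrightarrow> polyf (\<lambda>z. p z * q z)"

lemma polyf_sum: "(\<And>i. i \<in> I \<Longrightarrow> polyf (f i)) \<Longrightarrow> polyf (\<lambda>z. \<Sum>i\<in>I. f i z)"
  by (induction I rule: infinite_finite_induct) (auto intro: polyf.intros)

lemma polyf_prod: "(\<And>i. i \<in> I \<Longrightarrow> polyf (f i)) \<Longrightarrow> polyf (\<lambda>z. \<Prod>i\<in>I. f i z)"
  by (induction I rule: infinite_finite_induct) (auto intro: polyf.intros)

lemma polyf_power: "polyf p \<Longrightarrow> polyf (\<lambda>z. p z ^ n)"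
  by (induction n) (auto intro: polyf.intros)

lemma poly_fun_imp_polyf:
  assumes "poly_fun p"
  shows "polyf p"
proof -
  obtain S c where "finite (S :: (nat^'a) set)" "\<And>z. p z = (\<Sum>\<alpha>\<in>S. c \<alpha> * (\<Prod>j\<in>UNIV. (z$j) ^ (\<alpha>$j)))"
    using assms unfolding poly_fun_def by blast
  then have "p = (\<lambda>z. \<Sum>\<alpha>\<in>S. c \<alpha> * (\<Prod>j\<in>UNIV. (z$j) ^ (\<alpha>$j)))" by auto
  then show ?thesis
    by (simp only:) (intro polyf_sum polyf.mult polyf.const polyf_prod polyf_power polyf.coord)
qed

lemma polyf_continuous: "polyf p \<Longrightarrow> continuous_on UNIV p"
  by (induction rule: polyf.induct) (auto intro!: continuous_intros)

lemma polyf_holomorphic: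
  assumes "polyf p" "\<And>i. (\<lambda>s. f s $ i) holomorphic_on S"
  shows "(\<lambda>s. p (f s)) holomorphic_on S"
  using assms(1) by (induction rule: polyf.induct) (auto intro!: holomorphic_intros assms(2))

text \<open>The \<open>dp j\<close> are the partial derivatives, characterised by the chain rule
  along curves, which keeps all differentiation in one complex variable.\<close>

definition has_poly_gradient :: "(complex^'d \<Rightarrow> complex) \<Rightarrow> ('d \<Rightarrow> complex^'d \<Rightarrow> complex) \<Rightarrow> bool" where
  "has_poly_gradient p dp \<longleftrightarrow> (\<forall>j. polyf (dp j)) \<and>
    (\<forall>f f' s. (\<forall>j. ((\<lambda>s. f s $ j) has_field_derivative f' j) (at s)) \<longrightarrow>
      ((\<lambda>s. p (f s)) has_field_derivative (\<Sum>j\<in>UNIV. dp j (f s) * f' j)) (at s))"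

lemma has_poly_gradientD:
  assumes "has_poly_gradient p dp"
  shows "polyf (dp j)"
    and "(\<And>j. ((\<lambda>s. f s $ j) has_field_derivative f' j) (at s)) \<Longrightarrow>
      ((\<lambda>s. p (f s)) has_field_derivative (\<Sum>j\<in>UNIV. dp j (f s) * f' j)) (at s)"
  using assms unfolding has_poly_gradient_def by blast+

lemma polyf_gradient:
  assumes "polyf (p :: complex^'d \<Rightarrow> complex)"
  shows "\<exists>dp. has_poly_gradient p dp"
  using assms
proof (induction rule: polyf.induct)
  case (const c)
  show ?case
    by (intro exI[of _ "\<lambda>j z. 0"]) (auto simp: has_poly_gradient_def intro: polyf.intros)
next
  case (coord i)
  have "has_poly_gradient (\<lambda>z. z $ i) (\<lambda>j z. if j = i then 1 else 0)"
    unfolding has_poly_gradient_def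
  proof (intro conjI allI impI)
    fix f f' s assume f: "\<forall>j. ((\<lambda>s. (f s :: complex^'d) $ j) has_field_derivative f' j) (at s)"
    have "(\<Sum>j\<in>UNIV. (if j = i then 1 else 0) * f' j) = f' i"
      by (simp add: if_distrib[of "\<lambda>x. x * _"] cong: if_cong)
    then show "((\<lambda>s. f s $ i) has_field_derivative (\<Sum>j\<in>UNIV. (if j = i then 1 else 0) * f' j)) (at s)"
      using f by simp
  qed (rule polyf.const)
  then show ?case by blast
next
  case (add p q)
  then obtain dp dq where d: "has_poly_gradient p dp" "has_poly_gradient q dq" by blast
  have "has_poly_gradient (\<lambda>z. p z + q z) (\<lambda>j z. dp j z + dq j z)"
    unfolding has_poly_gradient_def
  proof (intro conjI allI impI)
    fix f f' s assume "\<forall>j. ((\<lambda>s. (f s :: complex^'d) $ j) has_field_derivative f' j) (at s)"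
    then have f: "\<And>j. ((\<lambda>s. f s $ j) has_field_derivative f' j) (at s)" by blast
    show "((\<lambda>s. p (f s) + q (f s)) has_field_derivative (\<Sum>j\<in>UNIV. (dp j (f s) + dq j (f s)) * f' j)) (at s)"
      using DERIV_add[OF has_poly_gradientD(2)[OF d(1) f] has_poly_gradientD(2)[OF d(2) f]]
      by (simp add: distrib_right sum.distrib)
  qed (intro polyf.add has_poly_gradientD(1)[OF d(1)] has_poly_gradientD(1)[OF d(2)])
  then show ?case by blast
next
  case (mult p q)
  then obtain dp dq where d: "has_poly_gradient p dp" "has_poly_gradient q dq" by blast
  have "has_poly_gradient (\<lambda>z. p z * q z) (\<lambda>j z. dp j z * q z + dq j z * p z)"
    unfolding has_poly_gradient_def
  proof (intro conjI allI impI)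
    fix f f' s assume "\<forall>j. ((\<lambda>s. (f s :: complex^'d) $ j) has_field_derivative f' j) (at s)"
    then have f: "\<And>j. ((\<lambda>s. f s $ j) has_field_derivative f' j) (at s)" by blast
    show "((\<lambda>s. p (f s) * q (f s)) has_field_derivative (\<Sum>j\<in>UNIV. (dp j (f s) * q (f s) + dq j (f s) * p (f s)) * f' j)) (at s)"
      using DERIV_mult[OF has_poly_gradientD(2)[OF d(1) f] has_poly_gradientD(2)[OF d(2) f]]
      by (simp add: distrib_left distrib_right sum.distrib sum_distrib_right sum_distrib_left mult_ac)
  qed (intro polyf.add polyf.mult mult.hyps has_poly_gradientD(1)[OF d(1)] has_poly_gradientD(1)[OF d(2)])
  then show ?case by blast
qed

lemma polyf_det:
  fixes A :: "complex^'d \<Rightarrow> complex^'n^'n"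
  assumes "\<And>i j. polyf (\<lambda>z. A z $ i $ j)"
  shows "polyf (\<lambda>z. det (A z))"
  unfolding det_def by (intro polyf_sum polyf.mult polyf.const polyf_prod assms)

text \<open>The complex Jacobian matrix, tested along affine lines. The offset \<open>w\<close> fits
  the expressions \<open>F (a + (w + s) *s b)\<close> of the doubling argument.\<close>

definition is_jacobian :: "(complex^'d \<Rightarrow> complex^'d) \<Rightarrow> (complex^'d \<Rightarrow> complex^'d^'d) \<Rightarrow> bool" where
  "is_jacobian F A \<longleftrightarrow> (\<forall>i j. polyf (\<lambda>z. A z $ i $ j)) \<and>
    (\<forall>z c w i. ((\<lambda>s. F (z + (w + s) *s c) $ i) has_field_derivative (A (z + w *s c) *v c) $ i) (at 0))"

lemma poly_map_jacobian:
  fixes F :: "complex^'d \<Rightarrow> complex^'d"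
  assumes "poly_map F"
  obtains A where "is_jacobian F A"
proof -
  have "\<forall>i. \<exists>dp. has_poly_gradient (\<lambda>z. F z $ i) dp"
    using assms polyf_gradient[OF poly_fun_imp_polyf] unfolding poly_map_def by blast
  then obtain D where D: "\<And>i. has_poly_gradient (\<lambda>z. F z $ i) (D i)" by metis
  show ?thesis
  proof (rule that[of "\<lambda>z. \<chi> i j. D i j z"], unfold is_jacobian_def, intro conjI allI)
    show "polyf (\<lambda>z. (\<chi> i j. D i j z) $ i $ j)" for i j using has_poly_gradientD(1)[OF D] by simp
    fix z c :: "complex^'d" and w i
    have "((\<lambda>s. (z + (w + s) *s c) $ j) has_field_derivative c $ j) (at 0)" for j
      by (auto intro!: derivative_eq_intros)
    from has_poly_gradientD(2)[OF D this, of i]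
    show "((\<lambda>s. F (z + (w + s) *s c) $ i) has_field_derivative ((\<chi> i j. D i j (z + w *s c)) *v c) $ i) (at 0)"
      by (simp add: matrix_vector_mult_def)
  qed
qed

lemma poly_map_continuous:
  assumes "poly_map F"
  shows "continuous_on UNIV F"
proof -
  have "continuous_on UNIV (\<lambda>z. \<chi> i. F z $ i)"
    using assms polyf_continuous[OF poly_fun_imp_polyf]
    by (intro continuous_on_vec_lambda) (auto simp: poly_map_def)
  then show ?thesis by simp
qed

lemma poly_map_holomorphic:
  assumes "poly_map F" "\<And>i. (\<lambda>s. f s $ i) holomorphic_on S"
  shows "(\<lambda>s. F (f s) $ i) holomorphic_on S"
  using polyf_holomorphic[OF poly_fun_imp_polyf, of "\<lambda>z. F z $ i" f S] assms by (auto simp: poly_map_def)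

section \<open>Composition with a polynomial map\<close>

lemma psh_compose_poly_map:
  fixes F :: "complex^'d \<Rightarrow> complex^'d"
  assumes u: "psh u" and F: "poly_map F"
  shows "psh (\<lambda>z. u (F z))"
proof (rule psh_if_submean)
  have usc: "usc u" and fin: "\<And>z. u z < \<infinity>" using u by (auto simp: psh_def usc_def)
  note Fc = poly_map_continuous[OF F]
  show "usc (\<lambda>z. u (F z))" by (rule usc_compose[OF usc Fc])
  show "u (F z) < \<infinity>" for z by (rule fin)
  obtain A where "is_jacobian F A" using poly_map_jacobian[OF F] .
  then have A: "((\<lambda>s. F (z + (w + s) *s c) $ i) has_field_derivative (A (z + w *s c) *v c) $ i) (at 0)" for z c w i
    by (simp add: is_jacobian_def)
  fix a b p assume lt: "\<And>s. norm s = 1 \<Longrightarrow> u (F (a + s *s b)) < ereal (Re (poly p s))"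
  \<comment> \<open>The doubling relation is the graph of \<open>w \<mapsto> F (a + w *s b)\<close>,
    with \<open>z0 = F a\<close> over the centre.\<close>
  define g where "g = (\<lambda>z w. z - F (a + w *s b))"
  show "u (F a) \<le> ereal (Re (poly p 0))"
  proof (rule submean_doubling[OF usc fin, of g])
    show "continuous_on UNIV (\<lambda>x. g (fst x) (snd x))" unfolding g_def
      by (intro continuous_intros continuous_on_compose2[OF Fc]) auto
    show "(\<lambda>s. g (z + s *s c) (w + s) $ i) holomorphic_on UNIV" for z c w i
    proof -
      have "(\<lambda>s. F (a + (w + s) *s b) $ i) holomorphic_on UNIV"
        by (rule poly_map_holomorphic[OF F]) (auto intro!: holomorphic_intros)
      then show ?thesis unfolding g_def by (auto intro!: holomorphic_intros)
    qed
    \<comment> \<open>Moving \<open>z\<close> with the velocity of the curve cancels the first-order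
      change of \<open>g\<close>. The radius bound 1 is arbitrary, since \<open>u\<close> is submean
      at every radius.\<close>
    show "\<exists>c. (\<forall>i. deriv (\<lambda>s. g (z + s *s c) (w + s) $ i) 0 = 0) \<and>
        (\<exists>r0>0. \<forall>r. 0 < r \<and> r < r0 \<longrightarrow> submean_at u z c r)" for z w
    proof (intro exI[of _ "A (a + w *s b) *v b"] exI[of _ 1] conjI allI impI)
      fix i
      have "((\<lambda>s. g (z + s *s (A (a + w *s b) *v b)) (w + s) $ i) has_field_derivative 0) (at 0)"
        unfolding g_def using A[of a w b i] by (auto intro!: derivative_eq_intros)
      then show "deriv (\<lambda>s. g (z + s *s (A (a + w *s b) *v b)) (w + s) $ i) 0 = 0"
        by (rule DERIV_imp_deriv)
    qed (use psh_imp_submean_at[OF u] in auto)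
    have "compact ((\<lambda>w. F (a + w *s b)) ` cball 0 1)"
      by (intro compact_continuous_image continuous_on_compose2[OF Fc] continuous_intros) auto
    then have "bounded ((\<lambda>w. F (a + w *s b)) ` cball 0 1)" by (rule compact_imp_bounded)
    then obtain M where "\<forall>x\<in>(\<lambda>w. F (a + w *s b)) ` cball 0 1. norm x \<le> M"
      unfolding bounded_iff by blast
    then have M: "norm (F (a + w *s b)) \<le> M" if "norm w \<le> 1" for w using that by simp
    have "norm z \<le> M + 1" if "norm w \<le> 1" "norm (g z w) \<le> 1" for z w
      using M[OF that(1)] that(2) norm_triangle_sub[of z "F (a + w *s b)"] by (simp add: g_def)
    then show "bounded {z. \<exists>w. norm w \<le> 1 \<and> norm (g z w) \<le> 1}"
      unfolding bounded_iff by blast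
    show "poly p holomorphic_on UNIV" by (intro holomorphic_intros)
  qed (use lt in \<open>auto simp: g_def\<close>)
qed

section \<open>Nondegeneracy of the Jacobian of a proper map\<close>

text \<open>If the Jacobian vanished identically, then at a maximum of \<open>|z|\<^sup>2 - k |F z - F 0|\<^sup>2\<close> one could move
  in a kernel direction of the derivative of \<open>F\<close>: the first term is strictly subharmonic there, while the
  second one changes only to fourth order in the mean.\<close>
lemma proper_poly_map_jacobian_nonzero:
  fixes F :: "complex^'d \<Rightarrow> complex^'d"
  assumes F: "poly_map F" and proper: "is_proper_map F"
    and jac: "is_jacobian F A"
  shows "\<exists>z. det (A z) \<noteq> 0"
proof (rule ccontr)
  assume "\<not> ?thesis"
  then have det0: "det (A z) = 0" for z by blast
  note Fc = poly_map_continuous[OF F]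
  have "compact (F -` cball (F 0) 1)" using proper by (simp add: is_proper_map_def)
  then obtain R1 where "\<And>z. z \<in> F -` cball (F 0) 1 \<Longrightarrow> norm z \<le> R1"
    using compact_imp_bounded bounded_iff by metis
  then have R1: "\<And>z. norm (F z - F 0) \<le> 1 \<Longrightarrow> norm z \<le> R1"
    by (simp add: dist_norm norm_minus_commute)
  define R where "R = R1 + 1"
  have R: "norm z < R" if "norm (F z - F 0) \<le> 1" for z using R1[OF that] by (simp add: R_def)
  have Rpos: "0 < R" using R[of 0] by simp
  \<comment> \<open>With this weight, \<open>\<Psi> z \<ge> \<Psi> 0 = 0\<close> forces
    \<open>norm (F z - F 0) \<le> 1\<close> at the maximiser, which keeps it strictly inside the
    ball of radius \<open>R\<close>.\<close>
  define k where "k = R\<^sup>2"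
  define \<Psi> where "\<Psi> = (\<lambda>z. (norm z)\<^sup>2 - k * (norm (F z - F 0))\<^sup>2)"
  have "continuous_on (cball 0 R) \<Psi>" unfolding \<Psi>_def
    by (intro continuous_intros continuous_on_subset[OF Fc]) auto
  then obtain z where z: "norm z \<le> R" and zmax: "\<And>y. norm y \<le> R \<Longrightarrow> \<Psi> y \<le> \<Psi> z"
    using continuous_attains_sup[of "cball (0::complex^'d) R" \<Psi>] Rpos by auto
  have "0 \<le> \<Psi> z" using zmax[of 0] Rpos by (simp add: \<Psi>_def)
  moreover have "(norm z)\<^sup>2 \<le> R\<^sup>2" using z by (intro power_mono) auto
  ultimately have "R\<^sup>2 * (norm (F z - F 0))\<^sup>2 \<le> R\<^sup>2 * 1" by (simp add: \<Psi>_def k_def)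
  then have "(norm (F z - F 0))\<^sup>2 \<le> 1" using Rpos by (subst (asm) mult_le_cancel_left_pos) auto
  then have "norm (F z - F 0) \<le> 1" by (simp add: power_le_one_iff)
  then have zR: "norm z < R" by (rule R)
  obtain c where c: "c \<noteq> 0" "A z *v c = 0"
    using det0[of z] invertible_det_nz[of "A z"] invertible_left_inverse matrix_left_invertible_ker by blast
  define h where "h = (\<lambda>s. F (z + s *s c) - F z)"
  have hhol: "(\<lambda>s. h s $ i) holomorphic_on UNIV" for i
  proof -
    have "(\<lambda>s. F (z + s *s c) $ i) holomorphic_on UNIV"
      by (rule poly_map_holomorphic[OF F]) (auto intro!: holomorphic_intros)
    then show ?thesis unfolding h_def by (auto intro!: holomorphic_intros)
  qed
  have h0: "h 0 = 0" by (simp add: h_def)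
  have "deriv (\<lambda>s. h s $ i) 0 = 0" for i
  proof (rule DERIV_imp_deriv)
    show "((\<lambda>s. h s $ i) has_field_derivative 0) (at 0)"
      unfolding h_def using jac[unfolded is_jacobian_def, THEN conjunct2, rule_format, of z 0 c i] c(2) by (auto intro!: derivative_eq_intros)
  qed
  then obtain C where C: "C \<ge> 0" "\<And>s. norm s \<le> 1 \<Longrightarrow> (norm (h s))\<^sup>2 \<le> C * (norm s)^4"
    using vec_second_order_bound[OF hhol h0] by blast
  have kC: "0 \<le> k * C" using C(1) by (simp add: k_def)
  have cpos: "0 < norm c" using c(1) by simp
  define r where "r = Min {1, (R - norm z) / norm c, sqrt ((norm c)\<^sup>2 / (k * C + 1)) / 2}"
  have "0 < r" unfolding r_def using zR cpos kC by (subst Min_gr_iff) auto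
  have rle: "r \<le> 1" "r \<le> (R - norm z) / norm c" "r \<le> sqrt ((norm c)\<^sup>2 / (k * C + 1)) / 2"
    unfolding r_def by (rule Min_le; simp)+
  have rc: "r * norm c \<le> R - norm z" using rle(2) cpos by (simp add: field_simps)
  have rd: "k * C * r^4 < (norm c)\<^sup>2 * r\<^sup>2"
    using quartic_less_quadratic[OF kC _ \<open>0 < r\<close> rle(3)] cpos by simp
  \<comment> \<open>The holomorphic part of the change of \<Psi>. It vanishes at 0, whereas
    maximality forces its real part to be at most \<open>- \<eta> < 0\<close> on the whole circle,
    against the mean value property.\<close>
  define E where "E = (\<lambda>s. 2 * (\<Sum>i\<in>UNIV. (s *s c) $ i * cnj (z $ i)) -
      of_real (2 * k) * (\<Sum>i\<in>UNIV. h s $ i * cnj ((F z - F 0) $ i)))"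
  define \<eta> where "\<eta> = (norm c)\<^sup>2 * r\<^sup>2 - k * C * r^4"
  have E: "Re (E s) \<le> - \<eta>" if s: "norm s = r" for s
  proof -
    have "norm (z + s *s c) \<le> R"
      using norm_triangle_ineq[of z "s *s c"] rc s by (simp add: norm_vector_smult)
    then have "\<Psi> (z + s *s c) \<le> \<Psi> z" by (rule zmax)
    moreover have "(norm (z + s *s c))\<^sup>2 = (norm z)\<^sup>2 + 2 * Re (\<Sum>i\<in>UNIV. (s *s c) $ i * cnj (z $ i)) + (norm c)\<^sup>2 * r\<^sup>2"
      unfolding norm_add_sq_vec using s by (simp add: norm_vector_smult power_mult_distrib mult.commute)
    moreover have "k * (norm (F (z + s *s c) - F 0))\<^sup>2 \<le>
      k * ((norm (F z - F 0))\<^sup>2 + 2 * Re (\<Sum>i\<in>UNIV. h s $ i * cnj ((F z - F 0) $ i)) + C * r^4)"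
    proof (rule mult_left_mono)
      have "F (z + s *s c) - F 0 = (F z - F 0) + h s" by (simp add: h_def)
      then have "(norm (F (z + s *s c) - F 0))\<^sup>2 = (norm (F z - F 0))\<^sup>2 + 2 * Re (\<Sum>i\<in>UNIV. h s $ i * cnj ((F z - F 0) $ i)) + (norm (h s))\<^sup>2"
        by (simp only: norm_add_sq_vec)
      moreover have "(norm (h s))\<^sup>2 \<le> C * r^4" using C(2)[of s] s rle(1) by simp
      ultimately show "(norm (F (z + s *s c) - F 0))\<^sup>2 \<le> (norm (F z - F 0))\<^sup>2 + 2 * Re (\<Sum>i\<in>UNIV. h s $ i * cnj ((F z - F 0) $ i)) + C * r^4"
        by linarith
    qed (simp add: k_def)
    moreover have "Re (E s) = 2 * Re (\<Sum>i\<in>UNIV. (s *s c) $ i * cnj (z $ i)) - 2 * k * Re (\<Sum>i\<in>UNIV. h s $ i * cnj ((F z - F 0) $ i))"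
      unfolding E_def by (simp del: vector_minus_component vector_smult_component)
    ultimately show ?thesis unfolding \<Psi>_def \<eta>_def by (simp add: algebra_simps del: vector_minus_component vector_smult_component)
  qed
  have "E holomorphic_on UNIV" unfolding E_def
    by (simp, intro holomorphic_intros hhol)
  then have "E holomorphic_on ball 0 2" by (rule holomorphic_on_subset) simp
  then have "((\<lambda>t. Re (E (of_real r * cis t))) has_integral (2 * pi * Re (E 0))) {0..2*pi}"
    using \<open>0 < r\<close> rle(1) by (intro holomorphic_mean_value) auto
  moreover have "((\<lambda>t. - \<eta>) has_integral (2 * pi * (- \<eta>))) {0..2*pi}"
    using has_integral_const_real[of "-\<eta>" 0 "2*pi"] by simp
  ultimately have "2 * pi * Re (E 0) \<le> 2 * pi * (- \<eta>)"
    by (rule has_integral_le) (use E \<open>0 < r\<close> in \<open>simp add: norm_mult\<close>)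
  then have "Re (E 0) \<le> - \<eta>" by (subst (asm) mult_le_cancel_left_pos) auto
  moreover have "E 0 = 0" by (simp add: E_def h0)
  ultimately show False using rd by (simp add: \<eta>_def)
qed

subsection \<open>Maxima over the fibres of a proper polynomial map\<close>

definition ln_norm :: "complex \<Rightarrow> ereal" where
  "ln_norm x = (if x = 0 then -\<infinity> else ereal (ln (norm x)))"

lemma usc_ln_norm:
  fixes J :: "'a::topological_space \<Rightarrow> complex"
  assumes J: "continuous_on UNIV J" and e: "0 < e"
  shows "usc (\<lambda>z. ereal e * ln_norm (J z))"
  unfolding usc_def
proof
  fix c
  show "open {z. ereal e * ln_norm (J z) < c}"
  proof (cases c)
    case (real r)
    have "ereal e * ln_norm x < ereal r \<longleftrightarrow> norm x < exp (r / e)" for x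
    proof (cases "x = 0")
      case False
      then have "norm x < exp (r / e) \<longleftrightarrow> ln (norm x) < r / e"
        by (metis exp_less_cancel_iff exp_ln zero_less_norm_iff)
      then show ?thesis using e False by (simp add: ln_norm_def field_simps)
    qed (use e in \<open>auto simp: ln_norm_def\<close>)
    then have "{z. ereal e * ln_norm (J z) < c} = {z. norm (J z) < exp (r / e)}" using real by simp
    also have "open \<dots>" by (intro open_Collect_less continuous_intros J)
    finally show ?thesis .
  next
    case PInf
    have "ereal e * ln_norm x < \<infinity>" for x using e by (simp add: ln_norm_def)
    then show ?thesis using PInf by simp
  qed simp
qed

text \<open>Near a point with \<open>J \<noteq> 0\<close> there is a holomorphic logarithm
  \<open>L\<close> of \<open>J\<close> along the line, so the added term is the harmonic function
  \<open>e * Re L\<close> and moves into the majorant. The radius stays within the disc on which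
  \<open>L\<close> exists.\<close>

lemma submean_at_add_ln_norm:
  fixes v :: "complex^'d \<Rightarrow> ereal"
  assumes v: "psh v" and J: "polyf J" and e: "0 < e" and nz: "J z \<noteq> 0"
  shows "\<exists>r0>0. \<forall>r. 0 < r \<and> r < r0 \<longrightarrow> submean_at (\<lambda>z. v z + ereal e * ln_norm (J z)) z c r"
proof -
  let ?f = "\<lambda>s. J (z + s *s c)"
  have fhol: "?f holomorphic_on UNIV"
    by (rule polyf_holomorphic[OF J]) (auto intro!: holomorphic_intros)
  have "open {s. ?f s \<noteq> 0}"
    by (intro open_Collect_neq holomorphic_on_imp_continuous_on[OF fhol] continuous_intros)
  moreover have "0 \<in> {s. ?f s \<noteq> 0}" using nz by simp
  ultimately obtain \<rho> where \<rho>: "\<rho> > 0" "ball 0 \<rho> \<subseteq> {s. ?f s \<noteq> 0}"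
    unfolding open_contains_ball by blast
  have c1: "?f holomorphic_on ball 0 \<rho>" by (rule holomorphic_on_subset[OF fhol subset_UNIV])
  have c2: "contractible (ball (0::complex) \<rho>)" by (rule convex_imp_contractible[OF convex_ball])
  have c3: "?f s \<noteq> 0" if "s \<in> ball 0 \<rho>" for s using \<rho>(2) that by blast
  obtain L where L: "L holomorphic_on ball 0 \<rho>" "\<And>s. s \<in> ball 0 \<rho> \<Longrightarrow> ?f s = exp (L s)"
    by (rule contractible_imp_holomorphic_log[OF c1 c2 c3]) (simp, rule that)
  have ln: "ereal e * ln_norm (?f s) = ereal (e * Re (L s))" if "norm s < \<rho>" for s
  proof -
    have "s \<in> ball 0 \<rho>" using that by simp
    then have "ln_norm (?f s) = ln_norm (exp (L s))" using L(2) by metis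
    also have "\<dots> = ereal (Re (L s))" by (simp add: ln_norm_def)
    finally show ?thesis by simp
  qed
  have "submean_at (\<lambda>z. v z + ereal e * ln_norm (J z)) z c r" if r: "0 < r" "r < \<rho>" for r
    unfolding submean_at_def
  proof (intro allI impI)
    fix R H assume R: "r < R" and H: "H holomorphic_on ball 0 R"
      and le: "\<forall>s. norm s = r \<longrightarrow> v (z + s *s c) + ereal e * ln_norm (?f s) \<le> ereal (Re (H s))"
    let ?H = "\<lambda>s. H s - of_real e * L s"
    have "?H holomorphic_on ball 0 (min R \<rho>)"
      by (intro holomorphic_intros holomorphic_on_subset[OF H] holomorphic_on_subset[OF L(1)]) auto
    moreover have "v (z + s *s c) \<le> ereal (Re (?H s))" if "norm s = r" for s
      using le[rule_format, OF that] ln[of s] that r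
      by (cases "v (z + s *s c)") auto
    moreover have "r < min R \<rho>" using R r by simp
    ultimately have "v z \<le> ereal (Re (?H 0))"
      using psh_imp_submean_at[OF v r(1), of z c] unfolding submean_at_def by blast
    then show "v z + ereal e * ln_norm (J z) \<le> ereal (Re (H 0))"
      using ln[of 0] \<rho>(1) by (cases "v z") auto
  qed
  then show ?thesis using \<rho>(1) by blast
qed

text \<open>On the complex line from \<open>z0\<close> to \<open>z'\<close> the function
  \<open>J\<close> is not identically zero, so small circles about \<open>z0\<close> avoid its
  zeros; the maximum of \<open>v\<close> on such a circle is at least \<open>v z0\<close>.\<close>

lemma psh_le_nearby_nonzero:
  fixes v :: "complex^'d \<Rightarrow> ereal"
  assumes v: "psh v" and J: "polyf J" and "J z' \<noteq> 0" and U: "open U" "z0 \<in> U"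
  obtains z1 where "z1 \<in> U" "J z1 \<noteq> 0" "v z0 \<le> v z1"
proof -
  define b where "b = z' - z0"
  let ?f = "\<lambda>s. J (z0 + s *s b)"
  have fhol: "?f holomorphic_on UNIV"
    by (rule polyf_holomorphic[OF J]) (auto intro!: holomorphic_intros)
  have f1: "?f 1 \<noteq> 0" using assms(3) by (simp add: b_def)
  have "\<exists>r>0. \<forall>s. s \<noteq> 0 \<and> norm s < r \<longrightarrow> ?f s \<noteq> 0"
  proof (cases "?f 0 = 0")
    case True
    obtain r where "0 < r" "\<And>z. z \<in> ball 0 r - {0} \<Longrightarrow> ?f z \<noteq> 0"
      using isolated_zeros[OF fhol open_UNIV connected_UNIV UNIV_I True UNIV_I f1] by metis
    then show ?thesis by (intro exI[of _ r]) auto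
  next
    case False
    have "open {s. ?f s \<noteq> 0}"
      by (intro open_Collect_neq holomorphic_on_imp_continuous_on[OF fhol] continuous_intros)
    then show ?thesis using False unfolding open_contains_ball
      by (metis (mono_tags, lifting) mem_Collect_eq mem_ball_0 subsetD)
  qed
  then obtain r1 where r1: "r1 > 0" "\<And>s. s \<noteq> 0 \<Longrightarrow> norm s < r1 \<Longrightarrow> ?f s \<noteq> 0" by blast
  have op: "open ((\<lambda>s. z0 + s *s b) -` U)"
    by (rule open_vimage[OF U(1)]) (intro continuous_intros)
  have "0 \<in> (\<lambda>s. z0 + s *s b) -` U" using U(2) by simp
  then obtain r2 where r2: "r2 > 0" "ball 0 r2 \<subseteq> (\<lambda>s. z0 + s *s b) -` U"
    using openE[OF op] by blast
  define r where "r = min r1 r2 / 2"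
  have r: "0 < r" "r < r1" "r < r2" using r1(1) r2(1) by (auto simp: r_def min_def)
  have "usc v" using v by (simp add: psh_def usc_def)
  then have usc: "usc (\<lambda>s. v (z0 + s *s b))"
    by (rule usc_compose) (intro continuous_intros)
  have "sphere (0::complex) r \<noteq> {}" using r(1) by simp
  then obtain s where s: "s \<in> sphere 0 r" "\<And>t. t \<in> sphere 0 r \<Longrightarrow> v (z0 + t *s b) \<le> v (z0 + s *s b)"
    using usc_attains_max[OF usc compact_sphere] by blast
  have "v z0 \<le> v (z0 + s *s b)"
  proof (rule ccontr)
    assume "\<not> ?thesis"
    \<comment> \<open>A real constant in between serves as harmonic majorant; the maximum itself
      might be -\<infinity>.\<close>
    then obtain m :: real where m: "v (z0 + s *s b) < ereal m" "ereal m < v z0"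
      using ereal_dense2 by (metis not_le)
    have "v z0 \<le> ereal (Re (complex_of_real m))"
    proof (rule psh_imp_submean_at[OF v r(1), of z0 b, unfolded submean_at_def, rule_format])
      show "r < r + 1" "(\<lambda>_. complex_of_real m) holomorphic_on ball 0 (r + 1)" by auto
      show "v (z0 + t *s b) \<le> ereal (Re (complex_of_real m))" if "norm t = r" for t
        using s(2)[of t] m(1) that by simp
    qed
    then show False using m(2) by simp
  qed
  moreover have "norm s = r" using s(1) by simp
  moreover then have "z0 + s *s b \<in> U" using r2(2) r(3) by auto
  moreover have "?f s \<noteq> 0" using r1(2)[of s] \<open>norm s = r\<close> r by auto
  ultimately show ?thesis using that by blast
qed

text \<open>A convergent sequence together with its limit is compact, hence so is its preimage; the
  part of the preimage in \<open>S\<close> has a compact image, which therefore contains the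
  limit.\<close>

lemma closed_image_proper:
  assumes "continuous_on UNIV F" "is_proper_map F" "closed S"
  shows "closed (F ` S)"
  unfolding closed_sequential_limits
proof (intro allI impI, elim conjE)
  fix y l assume y: "\<forall>n. y n \<in> F ` S" and l: "y \<longlonglongrightarrow> l"
  have "compact (insert l (range y))"
    using compact_sequence_with_limit[OF l] .
  then have "compact (F -` insert l (range y))" using assms(2) by (simp add: is_proper_map_def)
  then have "compact (S \<inter> F -` insert l (range y))" using assms(3) by (rule closed_Int_compact[rotated])
  then have "compact (F ` (S \<inter> F -` insert l (range y)))"
    by (intro compact_continuous_image continuous_on_subset[OF assms(1)]) auto
  then have "closed (F ` (S \<inter> F -` insert l (range y)))" by (rule compact_imp_closed)
  moreover have "\<forall>n. y n \<in> F ` (S \<inter> F -` insert l (range y))"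
  proof
    fix n
    obtain x where "x \<in> S" "y n = F x" using y by blast
    moreover have "F x \<in> insert l (range y)" using \<open>y n = F x\<close> by (metis insertI2 rangeI)
    ultimately show "y n \<in> F ` (S \<inter> F -` insert l (range y))" by simp
  qed
  ultimately have "l \<in> F ` (S \<inter> F -` insert l (range y))"
    using l unfolding closed_sequential_limits by blast
  then show "l \<in> F ` S" by blast
qed

text \<open>The direct image of \<open>v\<close> under \<open>F\<close>; over an empty fibre the
  supremum is -\<infinity>.\<close>

definition fibre_max :: "(complex^'d \<Rightarrow> complex^'d) \<Rightarrow> (complex^'d \<Rightarrow> ereal) \<Rightarrow> complex^'d \<Rightarrow> ereal" where
  "fibre_max F v w = (SUP z\<in>F -` {w}. v z)"

lemma fibre_max_attained:
  assumes "is_proper_map F" "usc v" "F -` {w} \<noteq> {}"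
  obtains z where "F z = w" "fibre_max F v w = v z"
proof -
  have "compact (F -` {w})" using assms(1) by (simp add: is_proper_map_def)
  then obtain z where z: "z \<in> F -` {w}" "\<And>y. y \<in> F -` {w} \<Longrightarrow> v y \<le> v z"
    using usc_attains_max[OF assms(2) _ assms(3)] by blast
  then have "fibre_max F v w = v z" unfolding fibre_max_def
    by (intro antisym SUP_least SUP_upper) auto
  then show ?thesis using z that by blast
qed

text \<open>For \<open>c \<noteq> -\<infinity>\<close> the superlevel set is the image under
  \<open>F\<close> of that of \<open>v\<close>, because maxima over nonempty fibres are attained;
  and proper maps are closed.\<close>

lemma usc_fibre_max:
  assumes "continuous_on UNIV F" "is_proper_map F" "usc v"
  shows "usc (fibre_max F v)"
  unfolding usc_def
proof
  fix c
  show "open {w. fibre_max F v w < c}"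
  proof (cases "c = -\<infinity>")
    case False
    have "c \<le> fibre_max F v w \<longleftrightarrow> w \<in> F ` {z. c \<le> v z}" for w
    proof
      assume c: "c \<le> fibre_max F v w"
      then have "fibre_max F v w \<noteq> -\<infinity>" using False by auto
      then have "F -` {w} \<noteq> {}" by (auto simp: fibre_max_def bot_ereal_def)
      then show "w \<in> F ` {z. c \<le> v z}" using fibre_max_attained[OF assms(2,3)] c by (metis image_eqI mem_Collect_eq)
    next
      assume "w \<in> F ` {z. c \<le> v z}"
      then show "c \<le> fibre_max F v w" unfolding fibre_max_def by (auto intro: SUP_upper2)
    qed
    then have "{w. fibre_max F v w < c} = - (F ` {z. c \<le> v z})" by (auto simp: not_le[symmetric])
    then show ?thesis
      using closed_image_proper[OF assms(1,2) usc_closed_ge[OF assms(3)]] by (simp add: open_Compl)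
  qed simp
qed

text \<open>Adding a multiple of \<open>ln_norm (det (A z))\<close> sends \<open>W\<close> to
  -\<infinity> on the critical set, so directions are required only where
  \<open>A z *v c = b\<close> is solvable. At the noncritical point \<open>z1\<close> the added term
  is finite and disappears in the limit.\<close>

lemma submean_noncritical:
  fixes F :: "complex^'d \<Rightarrow> complex^'d"
  assumes F: "poly_map F" and proper: "is_proper_map F" and jac: "is_jacobian F A"
    and v: "psh v" and nz: "det (A z1) \<noteq> 0"
    and lt: "\<And>z s. norm s = 1 \<Longrightarrow> F z = F z1 + s *s b \<Longrightarrow> v z < ereal (Re (poly p s))"
  shows "v z1 \<le> ereal (Re (poly p 0))"
proof -
  have usc: "usc v" and fin: "\<And>z. v z < \<infinity>" using v by (auto simp: psh_def usc_def)
  note Fc = poly_map_continuous[OF F]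
  have J: "polyf (\<lambda>z. det (A z))" using jac by (intro polyf_det) (simp add: is_jacobian_def)
  note Jc = polyf_continuous[OF J]
  \<comment> \<open>This set contains every near-solution of \<open>F z = F z1 + w *s b\<close> over
    the closed disc; it supplies both the boundedness for the doubling and the bound
    \<open>M\<close> for the logarithm.\<close>
  have cpt: "compact (F -` cball (F z1) (norm b + 1))" using proper by (simp add: is_proper_map_def)
  have in_cpt: "z \<in> F -` cball (F z1) (norm b + 1)" if "norm w \<le> 1" "norm (F z - (F z1 + w *s b)) \<le> 1" for z w
  proof -
    have "norm (F z - F z1) \<le> norm (F z - (F z1 + w *s b)) + norm (w *s b)"
      using norm_triangle_ineq[of "F z - (F z1 + w *s b)" "w *s b"] by (simp add: algebra_simps)
    also have "\<dots> \<le> 1 + norm b"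
      using that mult_left_le_one_le[of "norm b" "norm w"] by (intro add_mono) (auto simp: norm_vector_smult)
    finally show ?thesis by (simp add: dist_norm norm_minus_commute)
  qed
  have "bounded ((\<lambda>z. det (A z)) ` (F -` cball (F z1) (norm b + 1)))"
    by (intro compact_imp_bounded compact_continuous_image continuous_on_subset[OF Jc] cpt) auto
  then obtain M0 where "\<forall>x\<in>(\<lambda>z. det (A z)) ` (F -` cball (F z1) (norm b + 1)). norm x \<le> M0"
    unfolding bounded_iff by blast
  then have M0: "norm (det (A z)) \<le> M0" if "z \<in> F -` cball (F z1) (norm b + 1)" for z
    using that by blast
  define M where "M = ln (max M0 1)"
  have M: "ln_norm (det (A z)) \<le> ereal M" if "z \<in> F -` cball (F z1) (norm b + 1)" for z
    using M0[OF that] by (auto simp: ln_norm_def M_def)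
  have key: "v z1 + ereal e * ln_norm (det (A z1)) \<le> ereal (Re (poly p 0) + e * M)" if e: "0 < e" for e
  proof -
    let ?W = "\<lambda>z. v z + ereal e * ln_norm (det (A z))"
    define g where "g = (\<lambda>z w. F z - (F z1 + w *s b))"
    have lnfin: "ereal e * ln_norm x < \<infinity>" for x using e by (simp add: ln_norm_def)
    \<comment> \<open>The majorant is raised by \<open>e * M\<close>, an upper bound for the
      logarithmic term on the fibres over the circle.\<close>
    have "?W z1 \<le> ereal (Re (poly p 0 + of_real (e * M)))"
    proof (rule submean_doubling[of ?W g])
      show "usc ?W" by (rule usc_add[OF usc usc_ln_norm[OF Jc e] fin lnfin])
      show "?W z < \<infinity>" for z using fin[of z] lnfin[of "det (A z)"] by simp
      show "continuous_on UNIV (\<lambda>x. g (fst x) (snd x))" unfolding g_def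
        by (intro continuous_intros continuous_on_compose2[OF Fc]) auto
      show "(\<lambda>s. g (z + s *s c) (w + s) $ i) holomorphic_on UNIV" for z c w i
      proof -
        have "(\<lambda>s. F (z + s *s c) $ i) holomorphic_on UNIV"
          by (rule poly_map_holomorphic[OF F]) (auto intro!: holomorphic_intros)
        then show ?thesis unfolding g_def by (auto intro!: holomorphic_intros)
      qed
      show "\<exists>c. (\<forall>i. deriv (\<lambda>s. g (z + s *s c) (w + s) $ i) 0 = 0) \<and>
          (\<exists>r0>0. \<forall>r. 0 < r \<and> r < r0 \<longrightarrow> submean_at ?W z c r)" if "?W z \<noteq> -\<infinity>" for z w
      proof -
        have nz': "det (A z) \<noteq> 0"
        proof
          assume "det (A z) = 0"
          then have "?W z = -\<infinity>" using e fin[of z] by (simp add: ln_norm_def)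
          then show False using \<open>?W z \<noteq> -\<infinity>\<close> by contradiction
        qed
        then have "surj (\<lambda>x. A z *v x)"
          using invertible_det_nz[of "A z"] invertible_right_inverse matrix_right_invertible_surjective by blast
        then obtain c where c: "b = A z *v c" by (rule surjE)
        have "deriv (\<lambda>s. g (z + s *s c) (w + s) $ i) 0 = 0" for i
        proof (rule DERIV_imp_deriv)
          have "((\<lambda>s. F (z + (0 + s) *s c) $ i) has_field_derivative (A (z + 0 *s c) *v c) $ i) (at 0)"
            using jac by (simp only: is_jacobian_def)
          then show "((\<lambda>s. g (z + s *s c) (w + s) $ i) has_field_derivative 0) (at 0)"
            unfolding g_def using c by (auto intro!: derivative_eq_intros)
        qed
        then show ?thesis using submean_at_add_ln_norm[OF v J e nz'] by blast
      qed
      show "bounded {z. \<exists>w. norm w \<le> 1 \<and> norm (g z w) \<le> 1}"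
        by (rule bounded_subset[OF compact_imp_bounded[OF cpt]]) (use in_cpt in \<open>auto simp: g_def\<close>)
      show "(\<lambda>s. poly p s + of_real (e * M)) holomorphic_on UNIV" by (intro holomorphic_intros)
      show "?W z < ereal (Re (poly p w + of_real (e * M)))" if w: "norm w = 1" "g z w = 0" for z w
      proof -
        have Fz: "F z = F z1 + w *s b" using w(2) by (simp add: g_def)
        then have "ln_norm (det (A z)) \<le> ereal M" using M in_cpt[of w z] w by simp
        then have "ereal e * ln_norm (det (A z)) \<le> ereal e * ereal M"
          using e by (intro ereal_mult_left_mono) auto
        moreover have "v z < ereal (Re (poly p w))" by (rule lt[OF w(1) Fz])
        ultimately have "?W z < ereal (Re (poly p w)) + ereal (e * M)"
          by (cases "v z"; cases "ereal e * ln_norm (det (A z))") auto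
        then show ?thesis by simp
      qed
      show "g z1 0 = 0" by (simp add: g_def)
    qed
    then show ?thesis by simp
  qed
  define d where "d = ln (norm (det (A z1)))"
  have key': "v z1 \<le> ereal (Re (poly p 0) + e * (M - d))" if "0 < e" for e
    using key[OF that] nz by (cases "v z1") (auto simp: ln_norm_def d_def algebra_simps)
  show ?thesis
  proof (rule ereal_le_epsilon2)
    fix \<epsilon> :: real assume \<epsilon>: "0 < \<epsilon>"
    have pos: "0 < \<bar>M - d\<bar> + 1" by simp
    \<comment> \<open>This choice of \<open>e\<close> keeps the error \<open>e * (M - d)\<close>
      below \<epsilon> for either sign of \<open>M - d\<close>; the added 1 avoids division by
      zero.\<close>
    have "\<epsilon> / (\<bar>M - d\<bar> + 1) * (M - d) \<le> \<epsilon> / (\<bar>M - d\<bar> + 1) * (\<bar>M - d\<bar> + 1)"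
      using \<epsilon> by (intro mult_left_mono) auto
    also have "\<dots> = \<epsilon>" using pos by simp
    finally show "v z1 \<le> ereal (Re (poly p 0)) + ereal \<epsilon>"
      using key'[of "\<epsilon> / (\<bar>M - d\<bar> + 1)"] \<epsilon> by (cases "v z1") auto
  qed
qed

text \<open>A point \<open>z0\<close> over the centre may be critical. It is traded for a nearby
  noncritical \<open>z1\<close> with \<open>v z0 \<le> v z1\<close>, and the circle is recentred at
  \<open>F z1\<close>, where the strict majorisation survives.\<close>

lemma psh_fibre_max:
  fixes F :: "complex^'d \<Rightarrow> complex^'d"
  assumes F: "poly_map F" and proper: "is_proper_map F" and v: "psh v"
  shows "psh (fibre_max F v)"
proof (rule psh_if_submean)
  have usc: "usc v" and fin: "\<And>z. v z < \<infinity>" using v by (auto simp: psh_def usc_def)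
  note Fc = poly_map_continuous[OF F]
  show uscu: "usc (fibre_max F v)" by (rule usc_fibre_max[OF Fc proper usc])
  show "fibre_max F v w < \<infinity>" for w
  proof (cases "F -` {w} = {}")
    case True
    then show ?thesis by (simp add: fibre_max_def bot_ereal_def)
  next
    case False
    then show ?thesis using fibre_max_attained[OF proper usc] fin by metis
  qed
  then have finu: "\<And>w. fibre_max F v w < \<infinity>" .
  obtain A where jac: "is_jacobian F A" using poly_map_jacobian[OF F] .
  have J: "polyf (\<lambda>z. det (A z))" using jac by (intro polyf_det) (simp add: is_jacobian_def)
  obtain z' where z': "det (A z') \<noteq> 0" using proper_poly_map_jacobian_nonzero[OF F proper jac] by blast
  fix a b p
  assume lt: "\<And>s. norm s = 1 \<Longrightarrow> fibre_max F v (a + s *s b) < ereal (Re (poly p s))"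
  \<comment> \<open>Strict majorisation is an open condition on centre and circle parameter jointly;
    by compactness of the circle, the tube lemma gives one neighbourhood \<open>X\<close> of
    \<open>a\<close> for all circle points.\<close>
  have "usc (\<lambda>x. fibre_max F v (fst x + snd x *s b) + ereal (- Re (poly p (snd x))))"
    by (intro usc_add usc_compose[OF uscu] usc_continuous continuous_intros) (use finu in auto)
  then have op: "open {x. fibre_max F v (fst x + snd x *s b) + ereal (- Re (poly p (snd x))) < 0}"
    by (rule uscD)
  have iff: "fibre_max F v w + ereal (- t) < 0 \<longleftrightarrow> fibre_max F v w < ereal t" for w t
    using finu[of w] by (cases "fibre_max F v w") auto
  have "{a} \<times> sphere 0 1 \<subseteq> {x. fibre_max F v (fst x + snd x *s b) + ereal (- Re (poly p (snd x))) < 0}"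
    unfolding iff using lt by auto
  from Elementary_Topology.tube_lemma[OF compact_sphere op this]
  obtain X where X: "a \<in> X" "open X"
    and sub: "X \<times> sphere 0 1 \<subseteq> {x. fibre_max F v (fst x + snd x *s b) < ereal (Re (poly p (snd x)))}"
    unfolding iff by blast
  have X3: "fibre_max F v (w + s *s b) < ereal (Re (poly p s))" if "w \<in> X" "norm s = 1" for w s
    using subsetD[OF sub, of "(w, s)"] that by simp
  show "fibre_max F v a \<le> ereal (Re (poly p 0))"
    unfolding fibre_max_def
  proof (rule SUP_least)
    fix z0 assume z0: "z0 \<in> F -` {a}"
    have "open (F -` X)" "z0 \<in> F -` X" using open_vimage[OF X(2) Fc] X(1) z0 by auto
    then obtain z1 where z1: "z1 \<in> F -` X" "det (A z1) \<noteq> 0" "v z0 \<le> v z1"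
      using psh_le_nearby_nonzero[OF v J z'] by blast
    have "v z1 \<le> ereal (Re (poly p 0))"
    proof (rule submean_noncritical[OF F proper jac v z1(2)])
      fix z s assume s: "norm s = 1" and Fz: "F z = F z1 + s *s b"
      have "v z \<le> fibre_max F v (F z1 + s *s b)"
        unfolding fibre_max_def using Fz by (intro SUP_upper) auto
      also have "\<dots> < ereal (Re (poly p s))" using X3 z1(1) s by simp
      finally show "v z < ereal (Re (poly p s))" .
    qed
    then show "v z0 \<le> ereal (Re (poly p 0))" using z1(3) by simp
  qed
qed

subsection \<open>The growth condition\<close>

lemma mon_abs_nonneg: "0 \<le> mon_abs z J"
  unfolding mon_abs_def by (intro prod_nonneg) auto

text \<open>The zero exponent provides the constant monomial 1, hence
  \<open>sup_mon C z \<ge> 1\<close> and a nonnegative \<open>H_C\<close>.\<close>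

lemma admissible_zero_mem:
  fixes C :: "(real^'d) set"
  assumes "admissible_body C"
  shows "0 \<in> C"
proof -
  obtain k :: nat where "0 < k" "std_simplex \<subseteq> (\<lambda>x. real k *\<^sub>R x) ` C"
    using assms by (auto simp: admissible_body_def)
  moreover have "(0::real^'d) \<in> std_simplex" by (simp add: std_simplex_def)
  ultimately obtain x where "x \<in> C" "0 = real k *\<^sub>R x" by blast
  then show ?thesis using \<open>0 < k\<close> by simp
qed

text \<open>Exponents are bounded and the base \<open>1 + norm z\<close> is at least 1, so each
  factor is at most one fixed power of it. This makes \<open>sup_mon\<close> a finite supremum,
  bounded on bounded sets.\<close>

lemma mon_abs_bound:
  fixes C :: "(real^'d) set"
  assumes "admissible_body C"
  obtains N where "N \<ge> 0" "\<And>z J. J \<in> C \<Longrightarrow> mon_abs z J \<le> (1 + norm z) powr N"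
proof -
  have "bounded C" using assms by (simp add: admissible_body_def convex_body_def compact_imp_bounded)
  then obtain M where M: "\<And>J. J \<in> C \<Longrightarrow> norm J \<le> M" unfolding bounded_iff by blast
  have M0: "0 \<le> M" using M[OF admissible_zero_mem[OF assms]] by simp
  have "mon_abs z J \<le> (1 + norm z) powr (M * real CARD('d))" if J: "J \<in> C" for z J
  proof -
    have "mon_abs z J \<le> (\<Prod>i\<in>(UNIV::'d set). (1 + norm z) powr M)"
      unfolding mon_abs_def
    proof (rule prod_mono, intro conjI)
      fix i
      have Ji: "0 \<le> J $ i" "J $ i \<le> M"
        using assms J M[OF J] component_le_norm_cart[of J i] by (auto simp: admissible_body_def)
      have zi: "norm (z $ i) \<le> norm z" by (rule Finite_Cartesian_Product.norm_nth_le)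
      show "0 \<le> (if J $ i = 0 then 1 else norm (z $ i) powr (J $ i))" by simp
      have "norm (z $ i) powr (J $ i) \<le> (1 + norm z) powr (J $ i)"
        using zi Ji by (intro powr_mono2) auto
      also have "\<dots> \<le> (1 + norm z) powr M" using Ji by (intro powr_mono) auto
      finally have "norm (z $ i) powr (J $ i) \<le> (1 + norm z) powr M" .
      moreover have "1 \<le> (1 + norm z) powr M" using M0 by (intro ge_one_powr_ge_zero) auto
      ultimately show "(if J $ i = 0 then 1 else norm (z $ i) powr (J $ i)) \<le> (1 + norm z) powr M" by simp
    qed
    also have "\<dots> = (1 + norm z) powr (M * real CARD('d))"
    proof -
      have "0 < 1 + norm z" by (simp add: add_pos_nonneg)
      then have "0 < (1 + norm z) powr M" by simp
      then show ?thesis using powr_realpow[of "(1 + norm z) powr M" "CARD('d)"] by (simp add: powr_powr)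
    qed
    finally show ?thesis .
  qed
  then show ?thesis using that[of "M * real CARD('d)"] M0 by simp
qed

lemma mon_abs_bdd_above: "admissible_body C \<Longrightarrow> bdd_above ((\<lambda>J. mon_abs z J) ` C)"
  using mon_abs_bound[of C] by (metis bdd_aboveI2)

lemma sup_mon_ge_1:
  assumes "admissible_body C"
  shows "1 \<le> sup_mon C z"
proof -
  have "mon_abs z 0 \<le> sup_mon C z" unfolding sup_mon_def
    by (rule cSUP_upper[OF admissible_zero_mem mon_abs_bdd_above]) (use assms in auto)
  then show ?thesis by (simp add: mon_abs_def)
qed

lemma sup_mon_bound:
  assumes "admissible_body C"
  obtains N where "N \<ge> 0" "\<And>z. sup_mon C z \<le> (1 + norm z) powr N"
proof -
  obtain N where N: "N \<ge> 0" "\<And>z J. J \<in> C \<Longrightarrow> mon_abs z J \<le> (1 + norm z) powr N"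
    using mon_abs_bound[OF assms] by blast
  have "sup_mon C z \<le> (1 + norm z) powr N" for z unfolding sup_mon_def
    by (rule cSUP_least) (use admissible_zero_mem[OF assms] N in auto)
  then show ?thesis using that N(1) by blast
qed

text \<open>Logarithm and supremum commute by monotonicity; the exponent \<open>J = 0\<close> keeps
  both sides above -\<infinity>.\<close>

lemma H_C_eq_ln_sup_mon:
  assumes "admissible_body C"
  shows "H_C C z = ereal (ln (sup_mon C z))"
proof (rule antisym)
  let ?l = "\<lambda>J. if mon_abs z J = 0 then -\<infinity> else ereal (ln (mon_abs z J))"
  show le: "H_C C z \<le> ereal (ln (sup_mon C z))"
    unfolding H_C_def
  proof (rule SUP_least)
    fix J assume J: "J \<in> C"
    have "mon_abs z J \<le> sup_mon C z" unfolding sup_mon_def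
      by (rule cSUP_upper[OF J mon_abs_bdd_above[OF assms]])
    then show "?l J \<le> ereal (ln (sup_mon C z))"
      using mon_abs_nonneg[of z J] sup_mon_ge_1[OF assms, of z] by auto
  qed
  have ge: "?l J \<le> H_C C z" if "J \<in> C" for J unfolding H_C_def by (rule SUP_upper[OF that])
  have "0 \<le> H_C C z" using ge[OF admissible_zero_mem[OF assms]] by (simp add: mon_abs_def zero_ereal_def)
  then obtain h where h: "H_C C z = ereal h" using le by (cases "H_C C z") auto
  have "sup_mon C z \<le> exp h" unfolding sup_mon_def
  proof (rule cSUP_least)
    fix J assume J: "J \<in> C"
    show "mon_abs z J \<le> exp h"
    proof (cases "mon_abs z J = 0")
      case False
      then have "0 < mon_abs z J" using mon_abs_nonneg[of z J] by simp
      moreover have "ln (mon_abs z J) \<le> h" using ge[OF J] False h by simp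
      ultimately show ?thesis by (metis exp_le_cancel_iff exp_ln)
    qed simp
  qed (use admissible_zero_mem[OF assms] in auto)
  then have "ln (sup_mon C z) \<le> h"
    using sup_mon_ge_1[OF assms, of z] by (metis ln_exp ln_le_cancel_iff exp_gt_zero less_le_trans zero_less_one)
  then show "ereal (ln (sup_mon C z)) \<le> H_C C z" by (simp add: h)
qed

text \<open>Joins a multiplicative bound outside a ball to a uniform bound inside: since
  \<open>g \<ge> 1\<close>, the constant \<open>max (max a b) 1\<close> serves in both regions, and
  its logarithm is the additive constant.\<close>

lemma ln_le_ln_plus_const:
  fixes f g :: "'a::real_normed_vector \<Rightarrow> real"
  assumes "\<And>z. 1 \<le> f z" "\<And>z. 1 \<le> g z" "\<And>z. R \<le> norm z \<Longrightarrow> f z \<le> a * g z"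
    "\<And>z. norm z \<le> R \<Longrightarrow> f z \<le> b"
  obtains c where "\<And>z. ln (f z) \<le> ln (g z) + c"
proof
  fix z
  let ?D = "max (max a b) 1"
  have g: "0 \<le> g z" "0 < g z" using assms(2)[of z] by linarith+
  have "f z \<le> ?D * g z"
  proof (cases "R \<le> norm z")
    case True
    have "a * g z \<le> ?D * g z" by (rule mult_right_mono) (use g in auto)
    then show ?thesis using assms(3)[OF True] by linarith
  next
    case False
    then have "f z \<le> ?D * 1" using assms(4)[of z] by simp
    also have "\<dots> \<le> ?D * g z" by (rule mult_left_mono[OF assms(2)]) simp
    finally show ?thesis .
  qed
  moreover have "0 < f z" using assms(1)[of z] by linarith
  ultimately have "ln (f z) \<le> ln (?D * g z)" by simp
  also have "\<dots> = ln (g z) + ln ?D" using g by (subst ln_mult) auto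
  finally show "ln (f z) \<le> ln (g z) + ln ?D" .
qed

text \<open>The limit superior gives the first comparison and the limit inferior the second, both
  for large \<open>z\<close> only; on the remaining balls the growth bound of \<open>sup_mon\<close>
  and the continuity of \<open>F\<close> take over.\<close>

lemma H_C_compare:
  fixes C C' :: "(real^'d) set" and F :: "complex^'d \<Rightarrow> complex^'d"
  assumes C: "admissible_body C" and C': "admissible_body C'" and F: "poly_map F"
    and inf: "0 < Liminf at_infinity (\<lambda>z. ereal (sup_mon C (F z) / sup_mon C' z))"
    and sup: "Limsup at_infinity (\<lambda>z. ereal (sup_mon C (F z) / sup_mon C' z)) < \<infinity>"
  obtains c1 c2 where "\<And>z. H_C C (F z) \<le> H_C C' z + ereal c1" "\<And>z. H_C C' z \<le> H_C C (F z) + ereal c2"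
proof -
  have pos: "0 < sup_mon C' z" for z using sup_mon_ge_1[OF C', of z] by linarith
  obtain A :: real where "Limsup at_infinity (\<lambda>z. ereal (sup_mon C (F z) / sup_mon C' z)) < ereal A"
    using sup ereal_dense2 by blast
  from Limsup_lessD[OF this] obtain R1 where "\<And>z. R1 \<le> norm z \<Longrightarrow> sup_mon C (F z) / sup_mon C' z < A"
    by (auto simp: eventually_at_infinity)
  then have up: "sup_mon C (F z) \<le> A * sup_mon C' z" if "R1 \<le> norm z" for z
    using that pos[of z] by (metis less_imp_le pos_divide_le_eq)
  obtain y :: real where y: "0 < ereal y" "ereal y < Liminf at_infinity (\<lambda>z. ereal (sup_mon C (F z) / sup_mon C' z))"
    using inf ereal_dense2 by blast
  from less_LiminfD[OF y(2)] obtain R2 where "\<And>z. R2 \<le> norm z \<Longrightarrow> y < sup_mon C (F z) / sup_mon C' z"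
    by (auto simp: eventually_at_infinity)
  then have "y * sup_mon C' z \<le> sup_mon C (F z)" if "R2 \<le> norm z" for z
    using that pos[of z] by (metis less_imp_le pos_le_divide_eq)
  then have lo: "sup_mon C' z \<le> (1 / y) * sup_mon C (F z)" if "R2 \<le> norm z" for z
    using that y(1) by (simp add: field_simps)
  obtain N where N: "N \<ge> 0" "\<And>z. sup_mon C z \<le> (1 + norm z) powr N" using sup_mon_bound[OF C] by blast
  obtain N' where N': "N' \<ge> 0" "\<And>z. sup_mon C' z \<le> (1 + norm z) powr N'" using sup_mon_bound[OF C'] by blast
  have "bounded (F ` cball 0 R1)"
    by (intro compact_imp_bounded compact_continuous_image continuous_on_subset[OF poly_map_continuous[OF F]]) auto
  then obtain M where "\<forall>x\<in>F ` cball 0 R1. norm x \<le> M" unfolding bounded_iff by blast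
  then have M: "norm (F z) \<le> M" if "norm z \<le> R1" for z using that by simp
  have upb: "sup_mon C (F z) \<le> (1 + M) powr N" if "norm z \<le> R1" for z
    using N(2)[of "F z"] powr_mono2[OF N(1), of "1 + norm (F z)" "1 + M"] M[OF that] by simp
  have lob: "sup_mon C' z \<le> (1 + R2) powr N'" if "norm z \<le> R2" for z
    using N'(2)[of z] powr_mono2[OF N'(1), of "1 + norm z" "1 + R2"] that by simp
  obtain c1 where "\<And>z. ln (sup_mon C (F z)) \<le> ln (sup_mon C' z) + c1"
    using ln_le_ln_plus_const[of "\<lambda>z. sup_mon C (F z)" "sup_mon C'", OF sup_mon_ge_1[OF C] sup_mon_ge_1[OF C'] up upb]
    by blast
  moreover obtain c2 where "\<And>z. ln (sup_mon C' z) \<le> ln (sup_mon C (F z)) + c2"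
    using ln_le_ln_plus_const[of "sup_mon C'" "\<lambda>z. sup_mon C (F z)", OF sup_mon_ge_1[OF C'] sup_mon_ge_1[OF C] lo lob]
    by blast
  ultimately show ?thesis
    using that[of c1 c2] by (simp add: H_C_eq_ln_sup_mon[OF C] H_C_eq_ln_sup_mon[OF C'])
qed

section \<open>Equality of the extremal functions\<close>

theorem theorem4p1:
  fixes C C' :: "(real^'d) set" and F :: "complex^'d \<Rightarrow> complex^'d"
  assumes "admissible_body C" and "admissible_body C'"
    and "poly_map F" and "is_proper_map F"
    and "0 < Liminf at_infinity (\<lambda>z. ereal (sup_mon C (F z) / sup_mon C' z))"
    and "Limsup at_infinity (\<lambda>z. ereal (sup_mon C (F z) / sup_mon C' z)) < \<infinity>"
  shows "\<forall>K. compact K \<longrightarrow> (\<forall>z. V_CK C K (F z) = V_CK C' (F -` K) z)"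
proof (intro allI impI antisym)
  fix K :: "(complex^'d) set" and z
  note F = assms(3) and proper = assms(4)
  obtain c1 c2 where c1: "\<And>z. H_C C (F z) \<le> H_C C' z + ereal c1"
    and c2: "\<And>z. H_C C' z \<le> H_C C (F z) + ereal c2"
    by (rule H_C_compare[OF assms(1-3,5,6)]) (rule that)
  \<comment> \<open>Each competitor \<open>u\<close> pulls back to a competitor
    \<open>u \<circ> F\<close>, its growth constant increased by \<open>c1\<close>.\<close>
  show "V_CK C K (F z) \<le> V_CK C' (F -` K) z"
    unfolding V_CK_def
  proof (rule SUP_least)
    fix u assume "u \<in> {u \<in> L_C C. \<forall>w\<in>K. u w \<le> 0}"
    then obtain c where u: "psh u" "\<And>w. u w \<le> H_C C w + ereal c" "\<And>w. w \<in> K \<Longrightarrow> u w \<le> 0"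
      by (auto simp: L_C_def)
    have "u (F x) \<le> H_C C' x + ereal (c1 + c)" for x
    proof -
      have "u (F x) \<le> H_C C (F x) + ereal c" by (rule u(2))
      also have "\<dots> \<le> (H_C C' x + ereal c1) + ereal c" by (intro add_right_mono c1)
      finally show ?thesis by (simp add: add.assoc)
    qed
    then have "(\<lambda>x. u (F x)) \<in> L_C C'"
      using psh_compose_poly_map[OF u(1) F] by (auto simp: L_C_def)
    then have "(\<lambda>x. u (F x)) \<in> {u \<in> L_C C'. \<forall>w\<in>F -` K. u w \<le> 0}" using u(3) by simp
    then show "u (F z) \<le> (SUP u\<in>{u \<in> L_C C'. \<forall>w\<in>F -` K. u w \<le> 0}. u z)"
      by (rule SUP_upper2) simp
  qed
  \<comment> \<open>Each competitor \<open>v\<close> pushes forward to \<open>fibre_max F v\<close>.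
    Fibres over \<open>K\<close> lie in the preimage of \<open>K\<close>, which gives the sign
    condition; and \<open>z\<close> lies in the fibre over \<open>F z\<close>, so the value there is
    at least \<open>v z\<close>.\<close>
  show "V_CK C' (F -` K) z \<le> V_CK C K (F z)"
    unfolding V_CK_def
  proof (rule SUP_least)
    fix v assume "v \<in> {u \<in> L_C C'. \<forall>w\<in>F -` K. u w \<le> 0}"
    then obtain c where v: "psh v" "\<And>w. v w \<le> H_C C' w + ereal c" "\<And>w. w \<in> F -` K \<Longrightarrow> v w \<le> 0"
      by (auto simp: L_C_def)
    have "fibre_max F v w \<le> H_C C w + ereal (c2 + c)" for w
      unfolding fibre_max_def
    proof (rule SUP_least)
      fix x assume x: "x \<in> F -` {w}"
      have "v x \<le> H_C C' x + ereal c" by (rule v(2))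
      also have "\<dots> \<le> (H_C C (F x) + ereal c2) + ereal c" by (intro add_right_mono c2)
      finally show "v x \<le> H_C C w + ereal (c2 + c)" using x by (simp add: add.assoc)
    qed
    then have "fibre_max F v \<in> L_C C"
      using psh_fibre_max[OF F proper v(1)] by (auto simp: L_C_def)
    moreover have "fibre_max F v w \<le> 0" if "w \<in> K" for w
      unfolding fibre_max_def by (rule SUP_least) (use v(3) that in auto)
    ultimately have mem: "fibre_max F v \<in> {u \<in> L_C C. \<forall>w\<in>K. u w \<le> 0}" by simp
    have "v z \<le> fibre_max F v (F z)" unfolding fibre_max_def by (rule SUP_upper) simp
    then show "v z \<le> (SUP u\<in>{u \<in> L_C C. \<forall>w\<in>K. u w \<le> 0}. u (F z))"
      by (rule SUP_upper2[OF mem])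
  qed
qed

end
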